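(* Let $r\geq 3$ and $k\geq 2$ be integers. For all positive integers $n$, $$\mathrm{ex}_L(n, C^r_{2k})\leq 64k^2r^{2r+3}\, n^{1+1/k}.$$
   Context: All hypergraphs are finite. An $r$-graph is an $r$-uniform hypergraph; it is linear if any two distinct edges share at most one vertex. The $r$-uniform linear cycle $C^r_\ell$ of length $\ell\ge3$ is the $r$-graph consisting of $\ell$ edges $e_1,\dots,e_\ell$ on $(r-1)\ell$ vertices such that $|e_i\cap e_j|=1$ if $j=i\pm 1$ (indices modulo $\ell$) and $|e_i\cap e_j|=0$ for all other $i\neq j$. For a linear $r$-graph $H$, the linear Turán number $\mathrm{ex}_L(n,H)$ is the maximum number of edges in an $n$-vertex linear $r$-graph that does not contain $H$ as a subgraph. *)

theory Defs
  imports Complex_Main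
begin

text \<open>A hypergraph is a pair of a vertex set and an edge set; isolated vertices are allowed.\<close>

type_synonym 'a hypergraph = "'a set \<times> 'a set set"

abbreviation verts :: "'a hypergraph \<Rightarrow> 'a set" where "verts \<equiv> fst"
abbreviation edges :: "'a hypergraph \<Rightarrow> 'a set set" where "edges \<equiv> snd"

definition rgraph :: "nat \<Rightarrow> 'a hypergraph \<Rightarrow> bool" where
  "rgraph r G \<longleftrightarrow> finite (verts G) \<and> (\<forall>e\<in>edges G. e \<subseteq> verts G \<and> card e = r)"

definition linear_rgraph :: "nat \<Rightarrow> 'a hypergraph \<Rightarrow> bool" where
  "linear_rgraph r G \<longleftrightarrow> rgraph r G \<and>
     (\<forall>e\<in>edges G. \<forall>f\<in>edges G. e \<noteq> f \<longrightarrow> card (e \<inter> f) \<le> 1)"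

text \<open>\<open>G\<close> contains \<open>H\<close> as a (not necessarily induced) subgraph, up to isomorphism of \<open>H\<close>.\<close>

definition contains_copy :: "'a hypergraph \<Rightarrow> 'b hypergraph \<Rightarrow> bool" where
  "contains_copy G H \<longleftrightarrow>
     (\<exists>f. inj_on f (verts H) \<and> f ` verts H \<subseteq> verts G \<and> (\<forall>e\<in>edges H. f ` e \<in> edges G))"

text \<open>Edges are indexed by \<open>0, \<dots>, l - 1\<close> modulo \<open>l\<close>. The number of vertices
  excludes isolated vertices and, for \<open>l = 3\<close>, three edges through one common vertex, so the
  predicate determines the hypergraph up to isomorphism.\<close>

definition is_linear_cycle :: "nat \<Rightarrow> nat \<Rightarrow> 'a hypergraph \<Rightarrow> bool" where
  "is_linear_cycle r l C \<longleftrightarrow> 3 \<le> l \<and> rgraph r C \<and> card (verts C) = (r - 1) * l \<and>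
     (\<exists>e. bij_betw e {..<l} (edges C) \<and>
        (\<forall>i<l. \<forall>j<l. i \<noteq> j \<longrightarrow>
           card (e i \<inter> e j) = (if j = (i + 1) mod l \<or> i = (j + 1) mod l then 1 else 0)))"

text \<open>The host graphs have vertices in \<^typ>\<open>nat\<close>, which is no restriction: see
  \<open>card_edges_le_exL\<close> below. The maximum is over a finite set, nonempty whenever \<open>H\<close> has
  an edge.\<close>

definition exL :: "nat \<Rightarrow> nat \<Rightarrow> 'b hypergraph \<Rightarrow> nat" where
  "exL r n H = Max {card (edges G) | G :: nat hypergraph.
     linear_rgraph r G \<and> card (verts G) = n \<and> \<not> contains_copy G H}"

lemma finite_exL_set:
  "finite {card (edges G) | G :: 'a hypergraph.
     linear_rgraph r G \<and> card (verts G) = n \<and> \<not> contains_copy G H}"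
proof (rule finite_subset)
  show "{card (edges G) | G :: 'a hypergraph.
     linear_rgraph r G \<and> card (verts G) = n \<and> \<not> contains_copy G H} \<subseteq> {..2 ^ n}"
  proof
    fix m assume "m \<in> {card (edges G) | G :: 'a hypergraph.
      linear_rgraph r G \<and> card (verts G) = n \<and> \<not> contains_copy G H}"
    then obtain G :: "'a hypergraph" where
      G: "m = card (edges G)" "linear_rgraph r G" "card (verts G) = n" by blast
    then have "finite (verts G)" "edges G \<subseteq> Pow (verts G)"
      by (auto simp: linear_rgraph_def rgraph_def)
    then show "m \<in> {..2 ^ n}"
      using G by (metis atMost_iff card_Pow card_mono finite_Pow_iff)
  qed
qed simp

lemma exL_set_nonempty:
  assumes "edges H \<noteq> {}"
  shows "{card (edges G) | G :: nat hypergraph.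
     linear_rgraph r G \<and> card (verts G) = n \<and> \<not> contains_copy G H} \<noteq> {}"
proof -
  have "linear_rgraph r ({..<n}, {})" "\<not> contains_copy ({..<n}, {}) H"
    using assms by (auto simp: linear_rgraph_def rgraph_def contains_copy_def)
  then show ?thesis
    by (intro ex_in_conv[THEN iffD1] exI CollectI conjI) (rule refl, simp_all)
qed

lemma card_edges_le_exL:
  fixes G :: "'a hypergraph"
  assumes G: "linear_rgraph r G" and n: "card (verts G) = n" and free: "\<not> contains_copy G H"
  shows "card (edges G) \<le> exL r n H"
proof -
  obtain V E where GE: "G = (V, E)" by (cases G)
  have V: "finite V" and E: "\<And>e. e \<in> E \<Longrightarrow> e \<subseteq> V \<and> card e = r"
    and lin: "\<And>e f. e \<in> E \<Longrightarrow> f \<in> E \<Longrightarrow> e \<noteq> f \<Longrightarrow> card (e \<inter> f) \<le> 1"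
    using G by (auto simp: GE linear_rgraph_def rgraph_def)
  obtain g :: "'a \<Rightarrow> nat" where g: "inj_on g V"
    using finite_imp_inj_to_nat_seg[OF V] by blast
  define h where "h = inv_into V g"
  have hg: "h ` g ` e = e" if "e \<subseteq> V" for e
    using that g by (force simp: h_def image_image)
  let ?G = "(g ` V, (`) g ` E)"
  have inj: "inj_on ((`) g) E"
    by (rule inj_onI) (metis E hg)
  have card_img: "card (g ` e) = card e" if "e \<subseteq> V" for e
    using that g by (meson card_image inj_on_subset)
  have "linear_rgraph r ?G"
    unfolding linear_rgraph_def rgraph_def
  proof (intro conjI ballI impI)
    fix e' f' assume "e' \<in> edges ?G" "f' \<in> edges ?G" "e' \<noteq> f'"
    then obtain e f where ef: "e \<in> E" "f \<in> E" "e' = g ` e" "f' = g ` f" "e \<noteq> f" by auto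
    then have "e' \<inter> f' = g ` (e \<inter> f)"
      using inj_on_image_Int[OF g, of e f] E by simp
    then show "card (e' \<inter> f') \<le> 1"
      using card_img[of "e \<inter> f"] E[OF ef(1)] lin[OF ef(1,2,5)] by (simp add: le_infI1)
  qed (use V E card_img in auto)
  moreover have "card (verts ?G) = n" using n g by (simp add: GE card_image)
  moreover have "\<not> contains_copy ?G H"
  proof
    assume "contains_copy ?G H"
    then obtain f where f: "inj_on f (verts H)" "f ` verts H \<subseteq> g ` V"
        "\<And>e. e \<in> edges H \<Longrightarrow> f ` e \<in> (`) g ` E"
      by (auto simp: contains_copy_def)
    have "inj_on (h \<circ> f) (verts H)"
      using f(1,2) unfolding h_def by (meson comp_inj_on inj_on_inv_into)
    moreover have "(h \<circ> f) ` verts H \<subseteq> V"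
      unfolding image_comp[symmetric] using image_mono[OF f(2), of h] hg[of V] by auto
    moreover have "(h \<circ> f) ` e \<in> E" if "e \<in> edges H" for e
      using f(3)[OF that] E hg unfolding image_comp[symmetric] by auto
    ultimately have "contains_copy G H"
      unfolding contains_copy_def GE by (intro exI[of _ "h \<circ> f"]) simp
    then show False using free by simp
  qed
  ultimately have "card (edges ?G) \<le> exL r n H"
    unfolding exL_def by (intro Max_ge finite_exL_set CollectI exI[of _ ?G]) simp
  then show ?thesis using inj by (simp add: GE card_image)
qed

lemma linear_cycle_exists:
  assumes r: "2 \<le> r" and l: "3 \<le> l"
  shows "\<exists>C :: (nat \<times> nat) hypergraph. is_linear_cycle r l C"
proof -
  define s where "s i = (i + 1) mod l" for i
  define e where "e i = {i} \<times> {..<r - 1} \<union> {(s i, 0::nat)}" for i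
  let ?C = "({..<l} \<times> {..<r - 1}, e ` {..<l})"
  have sl: "s i < l" for i using l by (simp add: s_def)
  have sni: "s i \<noteq> i" if "i < l" for i
    using l that by (cases "i + 1 = l") (auto simp: s_def)
  have sinj: "s i \<noteq> s j" if "i < l" "j < l" "i \<noteq> j" for i j
    using l that by (cases "i + 1 = l"; cases "j + 1 = l") (auto simp: s_def)
  have ss: "s (s i) \<noteq> i" if "i < l" for i
  proof (cases "i + 1 = l")
    case True then show ?thesis using l by (simp add: s_def)
  next
    case False then show ?thesis using l that by (cases "i + 2 = l") (auto simp: s_def)
  qed
  have card_e: "card (e i) = r" if "i < l" for i
    using sni[OF that] r unfolding e_def by (subst card_Un_disjoint) (auto simp: card_cartesian_product)
  have int: "card (e i \<inter> e j) = (if j = s i \<or> i = s j then 1 else 0)"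
    if ij: "i < l" "j < l" "i \<noteq> j" for i j
  proof -
    have "e i \<inter> e j = (if j = s i then {(j, 0)} else if i = s j then {(i, 0)} else {})"
      using ij sinj[OF ij] ss[OF ij(1)] ss[OF ij(2)] r unfolding e_def by auto
    then show ?thesis by auto
  qed
  have "inj_on e {..<l}"
  proof (rule inj_onI)
    fix i j assume ij: "i \<in> {..<l}" "j \<in> {..<l}" "e i = e j"
    show "i = j"
    proof (rule ccontr)
      assume "i \<noteq> j"
      then have "card (e i) \<le> 1" using int[of i j] ij by (auto split: if_splits)
      then show False using card_e[of i] ij r by simp
    qed
  qed
  moreover have "rgraph r ?C"
    using card_e sl r by (auto simp: rgraph_def e_def)
  ultimately have "is_linear_cycle r l ?C"
    unfolding is_linear_cycle_def using l int
    by (auto simp: bij_betw_def card_cartesian_product s_def intro!: exI[of _ e])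
  then show ?thesis by blast
qed

end

theory Submission
  imports Defs "HOL-Library.FuncSet"
begin

text \<open>
  A random colouring makes the host \<open>r\<close>-partite at the cost of a factor \<open>r ^ r\<close>, and a subgraph has
  minimum degree of order \<open>k r\<^sup>4 n powr (1 / k)\<close>. Grow a tree from a vertex, layer by layer. For each
  class \<open>q\<close> take a maximal family of edges which meet the tree in one top vertex of class \<open>q\<close> and are
  disjoint outside the tree. Every other edge at a top vertex of class \<open>q\<close> that avoids the lower
  layers meets the top layer or the family in a second vertex, so these edges form a bipartite
  graph on few vertices. If that graph is dense, a greedy path in it between
  two branches of the tree closes up through the tree to a cycle of length exactly \<open>2 k\<close>. If all
  these graphs are sparse, the edges touching the current layer are controlled by the largest
  of the families; extending the tree by that family (so only vertices of one class get children, and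
  branches part at vertices rather than inside edges, which makes all connections even)
  multiplies the layer size by more than \<open>n powr (1 / k)\<close>, which is impossible \<open>k\<close> times.
\<close>

section \<open>Linear paths and cycles\<close>

text \<open>Comparing each edge with the union of all later ones gives one-point contact with the
  next edge and disjointness from the others at once. The joints stay existential, so only the ends
  are parameters.\<close>

fun lpath :: "'a \<Rightarrow> 'a set list \<Rightarrow> 'a \<Rightarrow> bool" where
  "lpath u [] v \<longleftrightarrow> u = v"
| "lpath u (e # es) v \<longleftrightarrow>
     (\<exists>w. u \<in> e \<and> w \<in> e \<and> u \<noteq> w \<and> lpath w es v \<and> e \<inter> \<Union>(set es) \<subseteq> {w})"

lemma lpath_ConsE:
  assumes "lpath u (e # es) v"
  obtains w where "u \<in> e" "w \<in> e" "u \<noteq> w" "lpath w es v" "e \<inter> \<Union>(set es) \<subseteq> {w}"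
  using assms unfolding lpath.simps by (elim exE conjE)

lemma lpath_end_in: "lpath u es v \<Longrightarrow> es \<noteq> [] \<Longrightarrow> v \<in> \<Union>(set es)"
proof (induction es arbitrary: u)
  case (Cons e es)
  then obtain w where "w \<in> e" "lpath w es v" by auto
  then show ?case using Cons.IH[of w] by (cases "es = []") auto
qed simp

lemma lpath_snoc:
  assumes "lpath u es v" "v \<in> e" "w \<in> e" "v \<noteq> w" "\<Union>(set es) \<inter> e \<subseteq> {v}"
  shows "lpath u (es @ [e]) w"
  using assms
proof (induction es arbitrary: u)
  case Nil
  then show ?case by auto
next
  case (Cons f es)
  from Cons.prems(1) obtain z where
    z: "u \<in> f" "z \<in> f" "u \<noteq> z" "lpath z es v" "f \<inter> \<Union>(set es) \<subseteq> {z}"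
    by (rule lpath_ConsE)
  have "lpath z (es @ [e]) w"
    using Cons.prems(2-5) by (intro Cons.IH[OF z(4)]) (simp_all, blast)
  \<comment> \<open>\<open>f\<close> meets the new edge at most in \<open>v\<close>. Either
    \<open>v = z\<close>, or \<open>v\<close> lies on \<open>es\<close>, and then \<open>v\<close>
    in \<open>f\<close> again gives \<open>v = z\<close>.\<close>
  moreover have "f \<inter> \<Union>(set (es @ [e])) \<subseteq> {z}"
  proof (cases "es = []")
    case True
    then show ?thesis using z(4) Cons.prems(5) by auto
  next
    case False
    then have "v \<in> \<Union>(set es)" by (rule lpath_end_in[OF z(4)])
    then show ?thesis using z(5) Cons.prems(5) by auto
  qed
  ultimately show ?case using z by auto
qed

text \<open>Turns the recursion into intersection sizes by position, the form used by
  \<open>is_linear_cycle\<close>. The clauses on the ends serve to glue two paths.\<close>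

lemma lpath_nth:
  assumes "lpath u es v"
  shows "(es \<noteq> [] \<longrightarrow> u \<noteq> v) \<and> (\<forall>i<length es. u \<in> es ! i \<longleftrightarrow> i = 0) \<and>
    (\<forall>i<length es. v \<in> es ! i \<longleftrightarrow> Suc i = length es) \<and>
    (\<forall>i j. i < j \<longrightarrow> j < length es \<longrightarrow> card (es ! i \<inter> es ! j) = (if j = Suc i then 1 else 0))"
  using assms
proof (induction es arbitrary: u)
  case Nil
  then show ?case by simp
next
  case (Cons e es)
  from Cons.prems obtain w where
    w: "u \<in> e" "w \<in> e" "u \<noteq> w" "lpath w es v" "e \<inter> \<Union>(set es) \<subseteq> {w}"
    by (rule lpath_ConsE)
  have e: "e \<inter> es ! i \<subseteq> {w}" if "i < length es" for i
    using w(5) nth_mem[OF that] by blast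
  note IH = Cons.IH[OF w(4)]
  have wi: "w \<in> es ! i \<longleftrightarrow> i = 0" if "i < length es" for i
    using IH that by blast
  have vi: "v \<in> es ! i \<longleftrightarrow> Suc i = length es" if "i < length es" for i
    using IH that by blast
  have vin: "v \<in> \<Union>(set es)" if "es \<noteq> []"
    by (rule lpath_end_in[OF w(4) that])
  have uni: "u \<notin> es ! i" if "i < length es" for i
    using e[OF that] w(1,3) by blast
  have une: "u \<notin> \<Union>(set es)"
    using w by blast
  have nil: "es = [] \<Longrightarrow> v = w"
    using w(4) by simp
  have ve: "v \<in> e \<longleftrightarrow> es = []"
    using nil vin w IH by auto
  have ce: "card (e \<inter> es ! i) = (if i = 0 then 1 else 0)" if "i < length es" for i
  proof (cases "i = 0")
    case True
    then have "e \<inter> es ! i = {w}" using e[OF that] wi[OF that] w(2) by blast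
    then show ?thesis using True by simp
  next
    case False
    then have "e \<inter> es ! i = {}" using e[OF that] wi[OF that] by blast
    then show ?thesis using False by simp
  qed
  show ?case
  proof (intro conjI allI impI)
    show "u \<noteq> v" using nil vin une w by blast
  next
    fix i assume "i < length (e # es)"
    then show "u \<in> (e # es) ! i \<longleftrightarrow> i = 0" "v \<in> (e # es) ! i \<longleftrightarrow> Suc i = length (e # es)"
      using uni w(1) ve vi by (cases i; simp)+
  next
    fix i j assume "i < j" "j < length (e # es)"
    then show "card ((e # es) ! i \<inter> (e # es) ! j) = (if j = Suc i then 1 else 0)"
      using ce IH by (cases j; cases i) auto
  qed
qed

section \<open>Cycles glued from two paths, and their copies\<close>

text \<open>A cycle cut at two joints, to be assembled from a path through the tree and one outside
  it. Two edges on each side keep an edge of \<open>P\<close> from meeting an edge of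
  \<open>Q\<close> in both \<open>u\<close> and \<open>v\<close>.\<close>

definition has_lcycle :: "'a set set \<Rightarrow> nat \<Rightarrow> bool" where
  "has_lcycle E l \<longleftrightarrow> (\<exists>u v P Q. lpath u P v \<and> lpath v Q u \<and> set P \<union> set Q \<subseteq> E \<and>
     \<Union>(set P) \<inter> \<Union>(set Q) \<subseteq> {u, v} \<and> 2 \<le> length P \<and> 2 \<le> length Q \<and> length P + length Q = l)"

text \<open>The edge pattern of \<open>is_linear_cycle\<close> for a sequence inside a host, where
  no vertex set is available to be counted.\<close>

definition cyc_seq :: "nat \<Rightarrow> nat \<Rightarrow> (nat \<Rightarrow> 'a set) \<Rightarrow> bool" where
  "cyc_seq r l e \<longleftrightarrow> (\<forall>i<l. card (e i) = r) \<and>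
     (\<forall>i<l. \<forall>j<l. i \<noteq> j \<longrightarrow>
        card (e i \<inter> e j) = (if j = (i + 1) mod l \<or> i = (j + 1) mod l then 1 else 0))"

lemma has_lcycle_cyc_seq:
  assumes "has_lcycle E l" and card: "\<And>e. e \<in> E \<Longrightarrow> card e = r"
  shows "\<exists>e. cyc_seq r l e \<and> (\<forall>i<l. e i \<in> E)"
proof -
  obtain u v P Q where PQ: "lpath u P v" "lpath v Q u" "set P \<union> set Q \<subseteq> E"
    "\<Union>(set P) \<inter> \<Union>(set Q) \<subseteq> {u, v}" "2 \<le> length P" "2 \<le> length Q" "length P + length Q = l"
    using assms(1) unfolding has_lcycle_def by blast
  let ?g = "\<lambda>i. (P @ Q) ! i"
  let ?p = "length P"
  have inE: "?g i \<in> E" if "i < l" for i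
    using that PQ nth_mem[of i "P @ Q"] by auto
  note P = lpath_nth[OF PQ(1)] and Q = lpath_nth[OF PQ(2)]
  have uv: "u \<noteq> v" using P PQ(5) by force
  have main: "card (?g i \<inter> ?g j) = (if j = Suc i \<or> (i = 0 \<and> Suc j = l) then 1 else 0)"
    if ij: "i < j" "j < l" for i j
  proof -
    consider "j < ?p" | "?p \<le> i" | "i < ?p" "?p \<le> j" using ij by linarith
    then show ?thesis
    proof cases
      case 1
      then show ?thesis using ij P PQ by (auto simp: nth_append)
    next
      case 2
      then show ?thesis using ij Q PQ by (auto simp: nth_append)
    next
      case 3
      define j' where "j' = j - ?p"
      have j': "j' < length Q" "j = ?p + j'" using 3 ij PQ by (auto simp: j'_def)
      have u: "u \<in> P ! i \<longleftrightarrow> i = 0" "v \<in> P ! i \<longleftrightarrow> Suc i = ?p"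
        and v: "v \<in> Q ! j' \<longleftrightarrow> j' = 0" "u \<in> Q ! j' \<longleftrightarrow> Suc j' = length Q"
        using P Q 3(1) j'(1) by blast+
      have "P ! i \<inter> Q ! j' \<subseteq> {u, v}"
        using PQ(4) nth_mem[OF 3(1)] nth_mem[OF j'(1)] by blast
      \<comment> \<open>\<open>v\<close> lies only on the last edge of \<open>P\<close> and the
        first of \<open>Q\<close>, \<open>u\<close> only on the first of \<open>P\<close> and the
        last of \<open>Q\<close>.\<close>
      then have "P ! i \<inter> Q ! j' = (if Suc i = ?p \<and> j' = 0 then {v} else {}) \<union>
          (if i = 0 \<and> Suc j' = length Q then {u} else {})"
        using u v by auto
      moreover have "j = Suc i \<longleftrightarrow> Suc i = ?p \<and> j' = 0" using 3 j' by auto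
      moreover have "Suc j = l \<longleftrightarrow> Suc j' = length Q" using j' PQ by auto
      ultimately show ?thesis using 3 j' PQ(5,6) by (auto simp: nth_append)
    qed
  qed
  have mod: "(j = (i + 1) mod l \<or> i = (j + 1) mod l) \<longleftrightarrow> j = Suc i \<or> (i = 0 \<and> Suc j = l)"
    if "i < j" "j < l" for i j
    using that PQ(5-7) by (cases "Suc j = l") auto
  have "card (?g i \<inter> ?g j) = (if j = (i + 1) mod l \<or> i = (j + 1) mod l then 1 else 0)"
    if ij: "i < l" "j < l" "i \<noteq> j" for i j
  proof (cases "i < j")
    case True
    then show ?thesis using main[OF True ij(2)] mod[OF True ij(2)] by presburger
  next
    case False
    then have "j < i" using ij by simp
    from main[OF this ij(1)] mod[OF this ij(1)] show ?thesis
      by (metis Int_commute)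
  qed
  then show ?thesis using inE card unfolding cyc_seq_def by blast
qed

text \<open>Any enumeration composed with a transposition. It is used to put a joint of an edge at
  coordinate \<open>0\<close>.\<close>

lemma ex_bij_betw_lessThan_at_0:
  assumes "finite A" "a \<in> A"
  shows "\<exists>g. bij_betw g {..<card A} A \<and> g 0 = a"
proof -
  obtain h where h: "bij_betw h {..<card A} A"
    using ex_bij_betw_nat_finite[OF assms(1)] by (auto simp: atLeast0LessThan)
  then obtain t where t: "t < card A" "h t = a"
    using assms(2) unfolding bij_betw_def by (metis imageE lessThan_iff)
  let ?s = "\<lambda>i. if i = 0 then t else if i = t then 0 else i"
  have "bij_betw ?s {..<card A} {..<card A}"
    by (rule bij_betw_byWitness[where f' = ?s]) (use t in auto)
  from bij_betw_trans[OF this h] have "bij_betw (h \<circ> ?s) {..<card A} A" .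
  then show ?thesis using t by (intro exI[of _ "h \<circ> ?s"]) simp
qed

text \<open>The point \<open>(i, 0)\<close> is the joint of edge \<open>i\<close> with its
  predecessor; edge \<open>i\<close> borrows that of its successor.\<close>

definition model_edge :: "nat \<Rightarrow> nat \<Rightarrow> nat \<Rightarrow> (nat \<times> nat) set" where
  "model_edge r l i = {i} \<times> {..<r - 1} \<union> {((i + 1) mod l, 0)}"

text \<open>Any two cycles can be compared through the common model. Edge \<open>e i\<close>
  contributes its vertices except the joint with its successor, listed with the joint to its
  predecessor first.\<close>

lemma cyc_seq_param:
  assumes l: "4 \<le> l" and r: "2 \<le> r" and e: "cyc_seq r l e"
  shows "\<exists>\<phi>. inj_on \<phi> ({..<l} \<times> {..<r - 1}) \<and> (\<forall>i<l. \<phi> ` model_edge r l i = e i)"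
proof -
  define s where "s i = (i + 1) mod l" for i
  define p where "p i = (if i = 0 then l - 1 else i - 1)" for i
  have sl: "s i < l" for i using l by (simp add: s_def)
  have pl: "p i < l" "s (p i) = i" if "i < l" for i
    using l that by (auto simp: s_def p_def)
  have ps: "p (s i) = i" if "i < l" for i
    using l that by (cases "i + 1 = l") (auto simp: s_def p_def)
  have sne: "s i \<noteq> i" if "i < l" for i
    using l that by (cases "i + 1 = l") (auto simp: s_def)
  \<comment> \<open>This is where \<open>4 \<le> l\<close> enters: the neighbours of edge
    \<open>i\<close> are disjoint, so its two joints differ. For \<open>l = 3\<close> all edges
    could share one vertex.\<close>
  have far: "p i \<noteq> s i" "s (s i) \<noteq> p i" if "i < l" for i
    using l that by (cases "i + 1 = l"; cases "i + 2 = l"; auto simp: s_def p_def split: if_splits)+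
  have card: "card (e i) = r" "finite (e i)" if "i < l" for i
    using e r that unfolding cyc_seq_def by (auto intro: card_ge_0_finite)
  have int: "card (e i \<inter> e j) = (if j = s i \<or> i = s j then 1 else 0)" if "i < l" "j < l" "i \<noteq> j" for i j
    using e that unfolding cyc_seq_def s_def by blast
  have "\<exists>v. e i \<inter> e (s i) = {v}" if "i < l" for i
    using int[OF that sl, of i] sne[OF that] by (auto simp: card_1_singleton_iff)
  then obtain w where w: "\<And>i. i < l \<Longrightarrow> e i \<inter> e (s i) = {w i}" by metis
  have wp: "w (p i) \<in> e i - {w i}" if "i < l" for i
  proof -
    have a: "w (p i) \<in> e (p i) \<inter> e i" using w[OF pl(1)[OF that]] pl(2)[OF that] by auto
    have "e (p i) \<inter> e (s i) = {}"
      using int[of "p i" "s i"] far[OF that] pl[OF that] sl[of i] sne[OF that] card[OF pl(1)[OF that]] 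
      by (auto split: if_splits)
    then show ?thesis using a w[OF that] by auto
  qed
  have "\<exists>g. bij_betw g {..<r - 1} (e i - {w i}) \<and> g 0 = w (p i)" if "i < l" for i
  proof -
    have "card (e i - {w i}) = r - 1"
      using card[OF that] w[OF that] by (subst card_Diff_singleton) auto
    then show ?thesis
      using ex_bij_betw_lessThan_at_0[OF _ wp[OF that]] card[OF that] by auto
  qed
  then obtain g where g: "\<And>i. i < l \<Longrightarrow> bij_betw (g i) {..<r - 1} (e i - {w i})"
    "\<And>i. i < l \<Longrightarrow> g i 0 = w (p i)" by metis
  let ?\<phi> = "\<lambda>(i, a). g i a"
  have gin: "g i a \<in> e i" "g i a \<noteq> w i" if "i < l" "a < r - 1" for i a
    using bij_betwE[OF g(1)[OF that(1)]] that(2) by auto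
  have "inj_on ?\<phi> ({..<l} \<times> {..<r - 1})"
  proof (rule inj_onI, clarsimp)
    fix i a j b assume h: "i < l" "a < r - Suc 0" "j < l" "b < r - Suc 0" "g i a = g j b"
    have "i = j"
    proof (rule ccontr)
      assume "i \<noteq> j"
      have m: "g i a \<in> e i \<inter> e j" "g i a \<noteq> w i" "g i a \<noteq> w j" using gin[of i a] gin[of j b] h by auto
      then have "card (e i \<inter> e j) \<noteq> 0" using card[OF h(1)] by auto
      then have "j = s i \<or> i = s j" using int[OF h(1,3) \<open>i \<noteq> j\<close>] by presburger
      then show False using m w[OF h(1)] w[OF h(3)] by auto
    qed
    then show "i = j \<and> a = b"
      using g(1)[OF h(1)] h by (auto simp: bij_betw_def inj_on_def)
  qed
  moreover have "?\<phi> ` model_edge r l i = e i" if "i < l" for i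
  proof -
    have "?\<phi> ` model_edge r l i = g i ` {..<r - 1} \<union> {g (s i) 0}"
      by (force simp: model_edge_def s_def)
    also have "\<dots> = (e i - {w i}) \<union> {w i}"
      using g(1)[OF that] g(2)[OF sl] ps[OF that] by (simp add: bij_betw_def)
    also have "\<dots> = e i" using w[OF that] by auto
    finally show ?thesis .
  qed
  ultimately show ?thesis by blast
qed

lemma contains_copy_of_cyc_seq:
  assumes l: "4 \<le> l" and r: "2 \<le> r" and C: "is_linear_cycle r l C"
    and e: "cyc_seq r l e" "\<And>i. i < l \<Longrightarrow> e i \<in> edges G" and G: "rgraph r G"
  shows "contains_copy G C"
proof -
  obtain e' where e': "bij_betw e' {..<l} (edges C)"
    "\<forall>i<l. \<forall>j<l. i \<noteq> j \<longrightarrow> card (e' i \<inter> e' j) = (if j = (i + 1) mod l \<or> i = (j + 1) mod l then 1 else 0)"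
    and C': "rgraph r C" "card (verts C) = (r - 1) * l"
    using C unfolding is_linear_cycle_def by blast
  have e'C: "e' i \<in> edges C" if "i < l" for i using e'(1) that by (auto simp: bij_betw_def)
  have "cyc_seq r l e'"
    using e'(2) e'C C'(1) unfolding cyc_seq_def rgraph_def by blast
  from cyc_seq_param[OF l r this] obtain \<phi>' where \<phi>': "inj_on \<phi>' ({..<l} \<times> {..<r - 1})"
    "\<And>i. i < l \<Longrightarrow> \<phi>' ` model_edge r l i = e' i" by blast
  from cyc_seq_param[OF l r e(1)] obtain \<phi> where \<phi>: "inj_on \<phi> ({..<l} \<times> {..<r - 1})"
    "\<And>i. i < l \<Longrightarrow> \<phi> ` model_edge r l i = e i" by blast
  let ?D = "{..<l} \<times> {..<r - 1}"
  have D: "?D = (\<Union>i<l. model_edge r l i)"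
    using l r by (auto simp: model_edge_def)
  have "\<phi>' ` ?D \<subseteq> verts C"
    using \<phi>'(2) e'C C'(1) unfolding D image_UN rgraph_def by auto
  moreover have "card (\<phi>' ` ?D) = card (verts C)"
    using \<phi>'(1) C'(2) by (simp add: card_image card_cartesian_product)
  \<comment> \<open>Equal cardinalities leave no isolated vertex in \<open>C\<close>, so the
    embedding read off the model is defined on all of \<open>verts C\<close>.\<close>
  ultimately have VC: "\<phi>' ` ?D = verts C"
    using C'(1) by (simp add: card_subset_eq rgraph_def)
  have VG: "\<phi> ` ?D \<subseteq> verts G"
    using \<phi>(2) e(2) G unfolding D image_UN rgraph_def by auto
  define \<psi> where "\<psi> = inv_into ?D \<phi>'"
  have \<psi>: "bij_betw \<psi> (verts C) ?D"
    unfolding \<psi>_def using bij_betw_inv_into[of \<phi>' ?D "verts C"] \<phi>'(1) VC by (simp add: bij_betw_def)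
  have "inj_on (\<phi> \<circ> \<psi>) (verts C)"
    using \<psi> \<phi>(1) by (simp add: bij_betw_def comp_inj_on)
  moreover have "(\<phi> \<circ> \<psi>) ` verts C \<subseteq> verts G"
    using \<psi> VG by (auto simp: bij_betw_def image_comp[symmetric])
  moreover have "(\<phi> \<circ> \<psi>) ` f \<in> edges G" if f: "f \<in> edges C" for f
  proof -
    obtain i where i: "i < l" "f = e' i" using e'(1) f by (auto simp: bij_betw_def)
    have "model_edge r l i \<subseteq> ?D" using D i by auto
    then have "\<psi> ` f = model_edge r l i"
      unfolding i(2) \<phi>'(2)[OF i(1), symmetric] \<psi>_def using inv_into_image_cancel[OF \<phi>'(1)] by simp
    then show ?thesis using \<phi>(2)[OF i(1)] e(2)[OF i(1)] by (metis image_comp)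
  qed
  ultimately show ?thesis unfolding contains_copy_def by blast
qed

section \<open>Subgraphs of large minimum degree and partite subgraphs\<close>

text \<open>Deleting a vertex of degree at most \<open>s\<close> with its edges preserves
  \<open>s * card V < card E\<close>. The map \<open>inc\<close> covers both hypergraphs and the
  auxiliary bipartite graph.\<close>

lemma ex_large_min_degree:
  fixes inc :: "'e \<Rightarrow> 'v set"
  assumes "finite V" "finite E" "\<And>e. e \<in> E \<Longrightarrow> inc e \<subseteq> V" "s * card V < card E"
  shows "\<exists>E'. E' \<subseteq> E \<and> E' \<noteq> {} \<and> (\<forall>e\<in>E'. \<forall>v\<in>inc e. s < card {g \<in> E'. v \<in> inc g})"
  using assms
proof (induction "card V" arbitrary: V E)
  case 0
  then show ?case by (intro exI[of _ E]) auto
next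
  case (Suc m)
  show ?case
  proof (cases "\<forall>v\<in>V. s < card {g \<in> E. v \<in> inc g}")
    case True
    then show ?thesis using Suc.prems by (intro exI[of _ E]) auto
  next
    case False
    then obtain v where v: "v \<in> V" "card {g \<in> E. v \<in> inc g} \<le> s" by auto
    let ?E = "{g \<in> E. v \<notin> inc g}"
    have "card E = card ?E + card {g \<in> E. v \<in> inc g}"
      using Suc.prems(2) by (subst card_Un_disjoint[symmetric]) (auto intro: arg_cong[of _ _ card])
    moreover have cV: "card V = Suc (card (V - {v}))"
      using Suc.prems(1) v(1) by (metis card.remove)
    ultimately have "s * card (V - {v}) < card ?E"
      using Suc.prems(4) v(2) by simp
    then have "\<exists>E'. E' \<subseteq> ?E \<and> E' \<noteq> {} \<and> (\<forall>e\<in>E'. \<forall>v\<in>inc e. s < card {g \<in> E'. v \<in> inc g})"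
      using Suc cV by (intro Suc.hyps(1)[of "V - {v}"]) auto
    then show ?thesis by blast
  qed
qed

text \<open>Averaging over all maps from \<open>V\<close> to \<open>r\<close> colours: each edge is
  rainbow for at least the fraction \<open>1 / r ^ r\<close> of them.\<close>

lemma ex_partite_subgraph:
  fixes V :: "'a set"
  assumes V: "finite V" and E: "\<And>e. e \<in> E \<Longrightarrow> e \<subseteq> V \<and> card e = r" and r: "0 < r"
  shows "\<exists>c. (\<forall>v. c v < r) \<and> card E \<le> r ^ r * card {e \<in> E. inj_on c e}"
proof (rule ccontr)
  assume "\<not> ?thesis"
  then have small: "r ^ r * card {e \<in> E. inj_on c e} < card E" if "\<forall>v. c v < r" for c :: "'a \<Rightarrow> nat"
    using that by (metis not_le_imp_less)
  have finE: "finite E" using V E by (meson PowI finite_Pow_iff finite_subset subsetI)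
  let ?\<Phi> = "V \<rightarrow>\<^sub>E {..<r}"
  have fin\<Phi>: "finite ?\<Phi>" using V by (simp add: finite_PiE)
  have card\<Phi>: "card ?\<Phi> = r ^ card V" using V by (simp add: card_PiE)
  have ge: "r ^ card V \<le> r ^ r * card {c \<in> ?\<Phi>. inj_on c e}" if e: "e \<in> E" for e
  proof -
    have fe: "finite e" "e \<subseteq> V" "card e = r" using E[OF e] V by (auto intro: finite_subset)
    \<comment> \<open>Counting the extensions of a single bijection \<open>h\<close> on
      \<open>e\<close> already gives \<open>r ^ (card V - r)\<close> colourings.\<close>
    obtain h where h: "bij_betw h e {..<r}"
      using finite_same_card_bij[of e "{..<r}"] fe by auto
    let ?\<Psi> = "(V - e) \<rightarrow>\<^sub>E {..<r}"
    let ?ext = "\<lambda>d v. if v \<in> e then h v else d v"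
    have "inj_on ?ext ?\<Psi>"
    proof (rule inj_onI)
      fix d d' assume d: "d \<in> ?\<Psi>" "d' \<in> ?\<Psi>" "?ext d = ?ext d'"
      show "d = d'"
      proof (rule PiE_ext[OF d(1,2)])
        fix v assume "v \<in> V - e"
        then show "d v = d' v" using fun_cong[OF d(3), of v] by simp
      qed
    qed
    moreover have "?ext ` ?\<Psi> \<subseteq> {c \<in> ?\<Phi>. inj_on c e}"
    proof -
      have "inj_on (?ext d) e" for d
        using h by (auto simp: bij_betw_def inj_on_def)
      moreover have "?ext d \<in> ?\<Phi>" if "d \<in> ?\<Psi>" for d
        using that h fe by (auto simp: PiE_iff extensional_def bij_betw_def)
      ultimately show ?thesis by blast
    qed
    ultimately have "card ?\<Psi> \<le> card {c \<in> ?\<Phi>. inj_on c e}"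
      using fin\<Phi> by (intro card_inj_on_le[of ?ext]) auto
    moreover have "r ^ card V = r ^ r * card ?\<Psi>"
    proof -
      have "card ?\<Psi> = r ^ (card V - r)" using V fe by (simp add: card_PiE card_Diff_subset)
      moreover have "r \<le> card V" using card_mono[OF V fe(2)] fe(3) by simp
      ultimately show ?thesis by (simp flip: power_add)
    qed
    ultimately show ?thesis by simp
  qed
  have "r ^ card V * card E \<le> (\<Sum>e\<in>E. r ^ r * card {c \<in> ?\<Phi>. inj_on c e})"
    using sum_mono[of E "\<lambda>_. r ^ card V"] ge by (simp add: mult.commute)
  also have "\<dots> = (\<Sum>c\<in>?\<Phi>. r ^ r * card {e \<in> E. inj_on c e})"
    unfolding sum_distrib_left[symmetric]
    by (intro arg_cong[of _ _ "(*) (r ^ r)"] sum_multicount_gen finE fin\<Phi>) simp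
  also have "\<dots> < (\<Sum>c\<in>?\<Phi>. card E)"
  proof (rule sum_strict_mono)
    show "?\<Phi> \<noteq> {}" using r by (auto simp: PiE_eq_empty_iff lessThan_empty_iff)
    fix c assume c: "c \<in> ?\<Phi>"
    \<comment> \<open>Extensional functions are \<open>undefined\<close> off \<open>V\<close>; the
      value \<open>0\<close> there meets the bound demanded for every \<open>v\<close>.\<close>
    let ?c = "\<lambda>v. if v \<in> V then c v else 0"
    have "{e \<in> E. inj_on ?c e} = {e \<in> E. inj_on c e}"
      using E by (intro Collect_cong conj_cong refl inj_on_cong) auto
    moreover have "\<forall>v. ?c v < r" using c r by (auto simp: PiE_iff)
    ultimately show "r ^ r * card {e \<in> E. inj_on c e} < card E" using small[of ?c] by simp
  qed (rule fin\<Phi>)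
  also have "\<dots> = r ^ card V * card E" by (simp add: card\<Phi>)
  finally show False by simp
qed

section \<open>Layered trees in a partite linear hypergraph\<close>

locale partite_linear =
  fixes E :: "'a set set" and r :: nat and c :: "'a \<Rightarrow> nat"
  assumes finite_E: "finite E"
    and card_edge: "e \<in> E \<Longrightarrow> card e = r"
    and linear: "e \<in> E \<Longrightarrow> f \<in> E \<Longrightarrow> e \<noteq> f \<Longrightarrow> card (e \<inter> f) \<le> 1"
    and inj_c: "e \<in> E \<Longrightarrow> inj_on c e"
    and c_less: "c v < r"
    and r_ge: "2 \<le> r"
begin

lemma finite_edge: "e \<in> E \<Longrightarrow> finite e"
  using card_edge r_ge by (metis card.infinite not_numeral_le_zero)

lemma edge_eqI:
  assumes "e \<in> E" "f \<in> E" "u \<in> e \<inter> f" "v \<in> e \<inter> f" "u \<noteq> v"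
  shows "e = f"
proof (rule ccontr)
  assume "e \<noteq> f"
  then have "card (e \<inter> f) \<le> 1" using linear assms by blast
  moreover have "card {u, v} \<le> card (e \<inter> f)"
    using assms finite_edge by (intro card_mono) auto
  ultimately show False using assms(5) by simp
qed

lemma same_class_eqI: "e \<in> E \<Longrightarrow> u \<in> e \<Longrightarrow> v \<in> e \<Longrightarrow> c u = c v \<Longrightarrow> u = v"
  using inj_c by (meson inj_onD)

text \<open>By linearity edges through \<open>u\<close> are disjoint elsewhere, so each point of
  \<open>T\<close> spoils at most one of them.\<close>

lemma ex_edge_avoiding:
  assumes "G \<subseteq> E" "\<And>g. g \<in> G \<Longrightarrow> u \<in> g" "finite T" "card T < card G"
  shows "\<exists>g\<in>G. g \<inter> T \<subseteq> {u}"
proof (rule ccontr)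
  assume "\<not> ?thesis"
  then have "\<forall>g\<in>G. \<exists>t. t \<in> g \<inter> T \<and> t \<noteq> u" by blast
  then obtain t where t: "\<And>g. g \<in> G \<Longrightarrow> t g \<in> g \<inter> T \<and> t g \<noteq> u" by metis
  have "inj_on t G"
  proof (rule inj_onI)
    fix g h assume "g \<in> G" "h \<in> G" "t g = t h"
    then show "g = h" using edge_eqI[of g h u "t g"] assms(1,2) t[of g] t[of h] by auto
  qed
  then have "card G \<le> card T" using t assms(3) by (intro card_inj_on_le[of t]) auto
  then show False using assms(4) by simp
qed

text \<open>Distinct top edges of a tree meet only below the top layer, so for a top vertex this is
  its unique top edge, or empty if there is none.\<close>

definition blk :: "'a set set \<Rightarrow> 'a \<Rightarrow> 'a set" where
  "blk M v = \<Union>{e \<in> M. v \<in> e}"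

text \<open>What a path has to avoid in order to stay off \<open>S\<close> and to end at a vertex
  whose top edge misses \<open>S\<close>.\<close>

definition spread :: "'a set set \<Rightarrow> 'a set \<Rightarrow> 'a set" where
  "spread M S = S \<union> (\<Union>u\<in>S. blk M u)"

text \<open>\<open>Lo\<close> and \<open>K\<close> are the lower vertices and the top layer of a tree of height \<open>j\<close>, and
  \<open>M\<close> its top edges. Of the tree only the following is remembered: any
  set of top vertices of one class can be 2-coloured so that vertices of different
  colours are joined through the tree by paths of one and the same even length.\<close>

definition linked :: "nat \<Rightarrow> 'a set \<Rightarrow> 'a set set \<Rightarrow> 'a \<Rightarrow> 'a \<Rightarrow> bool" where
  "linked m Lo M a b \<longleftrightarrow> (\<exists>es. lpath a es b \<and> length es = 2 * m \<and> set es \<subseteq> E \<and>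
     \<Union>(set es) \<subseteq> Lo \<union> blk M a \<union> blk M b)"

lemma linkedE:
  assumes "linked m Lo M a b"
  obtains es where "lpath a es b" "length es = 2 * m" "set es \<subseteq> E"
    "\<Union>(set es) \<subseteq> Lo \<union> blk M a \<union> blk M b"
  using assms unfolding linked_def by (elim exE conjE)

lemma linkedI:
  "lpath a es b \<Longrightarrow> length es = 2 * m \<Longrightarrow> set es \<subseteq> E \<Longrightarrow>
    \<Union>(set es) \<subseteq> Lo \<union> blk M a \<union> blk M b \<Longrightarrow> linked m Lo M a b"
  unfolding linked_def by (intro exI[of _ es] conjI)

definition splits :: "nat \<Rightarrow> 'a set \<Rightarrow> 'a set \<Rightarrow> 'a set set \<Rightarrow> bool" where
  "splits j Lo K M \<longleftrightarrow> (\<forall>q X. X \<subseteq> {v \<in> K. c v = q} \<longrightarrow> (\<exists>a\<in>X. \<exists>b\<in>X. a \<noteq> b) \<longrightarrow>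
     (\<exists>(\<chi> :: 'a \<Rightarrow> bool) m. 1 \<le> m \<and> m \<le> j \<and> (\<exists>a\<in>X. \<exists>b\<in>X. \<chi> a \<noteq> \<chi> b) \<and>
        (\<forall>a\<in>X. \<forall>b\<in>X. \<chi> a \<noteq> \<chi> b \<longrightarrow> linked m Lo M a b)))"

lemma splitsE:
  assumes "splits j Lo K M" "X \<subseteq> {v \<in> K. c v = q}" "\<exists>a\<in>X. \<exists>b\<in>X. a \<noteq> b"
  obtains \<chi> :: "'a \<Rightarrow> bool" and m where "1 \<le> m" "m \<le> j" "\<exists>a\<in>X. \<exists>b\<in>X. \<chi> a \<noteq> \<chi> b"
    "\<And>a b. a \<in> X \<Longrightarrow> b \<in> X \<Longrightarrow> \<chi> a \<noteq> \<chi> b \<Longrightarrow> linked m Lo M a b"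
proof -
  note assms(1)[unfolded splits_def, THEN spec[of _ q], THEN spec[of _ X], THEN mp, OF assms(2),
      THEN mp, OF assms(3)]
  then show ?thesis by (elim exE conjE) (rule that, assumption+, blast)
qed

definition level :: "nat \<Rightarrow> 'a set \<Rightarrow> 'a set \<Rightarrow> 'a set set \<Rightarrow> bool" where
  "level j Lo K M \<longleftrightarrow> Lo \<inter> K = {} \<and> finite K \<and> M \<subseteq> E \<and>
     (\<forall>e\<in>M. e \<inter> Lo \<noteq> {} \<and> e \<subseteq> Lo \<union> K) \<and> (\<forall>e\<in>M. \<forall>f\<in>M. e \<noteq> f \<longrightarrow> e \<inter> f \<subseteq> Lo) \<and>
     splits j Lo K M"

lemma level_0: "level 0 {} {v} {}"
  unfolding level_def splits_def by auto

text \<open>Vertices of one class lie on different edges of \<open>N\<close>, so their branches part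
  at a vertex of an older layer. Paths between parents, all of class \<open>p\<close>, then lift to
  paths between children.\<close>

lemma level_Suc:
  assumes lev: "level j Lo K M" and N: "N \<subseteq> E" "\<And>e. e \<in> N \<Longrightarrow> e \<inter> Lo = {}"
    "\<And>e. e \<in> N \<Longrightarrow> \<exists>v. e \<inter> K = {v} \<and> c v = p"
    "\<And>e f. e \<in> N \<Longrightarrow> f \<in> N \<Longrightarrow> e \<noteq> f \<Longrightarrow> e \<inter> f \<subseteq> K"
  shows "level (Suc j) (Lo \<union> K) (\<Union>N - K) N"
proof -
  have finN: "finite (\<Union>N)"
    using N(1) finite_E finite_edge by (auto intro: finite_subset)
  have sp: "splits (Suc j) (Lo \<union> K) (\<Union>N - K) N"
    unfolding splits_def
  proof (intro allI impI)
    fix q X assume X: "X \<subseteq> {v \<in> \<Union>N - K. c v = q}" and two: "\<exists>a\<in>X. \<exists>b\<in>X. a \<noteq> b"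
    have "\<forall>x\<in>X. \<exists>e z. e \<in> N \<and> x \<in> e \<and> e \<inter> K = {z} \<and> c z = p"
      using X N(3) by blast
    then obtain t \<pi> where t: "\<And>x. x \<in> X \<Longrightarrow> t x \<in> N \<and> x \<in> t x \<and> t x \<inter> K = {\<pi> x} \<and> c (\<pi> x) = p"
      by metis
    have blk: "t x \<subseteq> blk N x" if "x \<in> X" for x
      using t[OF that] unfolding blk_def by blast
    have tE: "t x \<in> E" if "x \<in> X" for x using t[OF that] N(1) by blast
    have x\<pi>: "x \<noteq> \<pi> x" "\<pi> x \<in> t x" "\<pi> x \<in> K" "x \<notin> K" if "x \<in> X" for x
      using t[OF that] X that by auto
    have tne: "t a \<noteq> t b" if "a \<in> X" "b \<in> X" "a \<noteq> b" for a b
    proof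
      assume "t a = t b"
      moreover have "c a = c b" using X that by blast
      ultimately show False
        using same_class_eqI[OF tE[OF that(1)], of a b] t[OF that(1)] t[OF that(2)] that(3) by simp
    qed
    have tt: "t a \<inter> t b \<subseteq> {\<pi> a} \<inter> {\<pi> b}" if "a \<in> X" "b \<in> X" "a \<noteq> b" for a b
      using N(4)[OF _ _ tne[OF that]] t[OF that(1)] t[OF that(2)] by blast
    show "\<exists>(\<chi> :: 'a \<Rightarrow> bool) m. 1 \<le> m \<and> m \<le> Suc j \<and> (\<exists>a\<in>X. \<exists>b\<in>X. \<chi> a \<noteq> \<chi> b) \<and>
        (\<forall>a\<in>X. \<forall>b\<in>X. \<chi> a \<noteq> \<chi> b \<longrightarrow> linked m (Lo \<union> K) N a b)"
    proof (cases "\<exists>a\<in>\<pi> ` X. \<exists>b\<in>\<pi> ` X. a \<noteq> b")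
      \<comment> \<open>Distinct parents: colour each vertex like its parent and prolong the path
        between parents by one edge at each end, so \<open>m\<close> grows by one.\<close>
      case True
      have "\<pi> ` X \<subseteq> {v \<in> K. c v = p}" using t by blast
      moreover have "splits j Lo K M" using lev unfolding level_def by blast
      ultimately obtain \<chi> :: "'a \<Rightarrow> bool" and m where \<chi>: "1 \<le> m" "m \<le> j"
        "\<exists>a\<in>\<pi> ` X. \<exists>b\<in>\<pi> ` X. \<chi> a \<noteq> \<chi> b"
        and conn: "\<And>a b. a \<in> \<pi> ` X \<Longrightarrow> b \<in> \<pi> ` X \<Longrightarrow> \<chi> a \<noteq> \<chi> b \<Longrightarrow> linked m Lo M a b"
        using True by - (rule splitsE[of j Lo K M "\<pi> ` X" p], assumption+, rule that, assumption+)
      have blkM: "blk M v \<subseteq> Lo \<union> K" for v using lev unfolding level_def blk_def by blast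
      have "linked (Suc m) (Lo \<union> K) N a b"
        if ab: "a \<in> X" "b \<in> X" "\<chi> (\<pi> a) \<noteq> \<chi> (\<pi> b)" for a b
      proof -
        obtain es where es: "lpath (\<pi> a) es (\<pi> b)" "length es = 2 * m" "set es \<subseteq> E"
          "\<Union>(set es) \<subseteq> Lo \<union> blk M (\<pi> a) \<union> blk M (\<pi> b)"
          by (rule linkedE[OF conn[OF imageI[OF ab(1)] imageI[OF ab(2)] ab(3)]])
        have LK: "\<Union>(set es) \<subseteq> Lo \<union> K" using es(4) blkM[of "\<pi> a"] blkM[of "\<pi> b"] by blast
        have tLK: "t x \<inter> (Lo \<union> K) \<subseteq> {\<pi> x}" if "x \<in> X" for x
          using t[OF that] N(2) by blast
        have ne: "a \<noteq> b" "\<pi> a \<noteq> \<pi> b" using ab by auto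
        \<comment> \<open>The old path lies in \<open>Lo \<union> K\<close>, where each new edge has
          only its parent vertex.\<close>
        have 1: "\<Union>(set es) \<inter> t b \<subseteq> {\<pi> b}" using LK tLK[OF ab(2)] by blast
        have "lpath (\<pi> a) (es @ [t b]) b"
          using lpath_snoc[OF es(1) x\<pi>(2)[OF ab(2)] _ x\<pi>(1)[OF ab(2), symmetric] 1] t[OF ab(2)] by blast
        moreover have "t a \<inter> \<Union>(set (es @ [t b])) \<subseteq> {\<pi> a}"
          using LK tLK[OF ab(1)] tt[OF ab(1,2) ne(1)] by auto
        ultimately have "lpath a (t a # es @ [t b]) b"
          using t[OF ab(1)] x\<pi>[OF ab(1)] unfolding lpath.simps(2) by (intro exI[of _ "\<pi> a"]) simp
        moreover have "\<Union>(set (t a # es @ [t b])) \<subseteq> Lo \<union> K \<union> blk N a \<union> blk N b"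
          using LK blk[OF ab(1)] blk[OF ab(2)] by auto
        moreover have "set (t a # es @ [t b]) \<subseteq> E"
          using es(3) tE ab by auto
        ultimately show ?thesis using es(2) by (intro linkedI[of a "t a # es @ [t b]"]) simp_all
      qed
      then show ?thesis
        using \<chi> by (intro exI[of _ "\<lambda>v. \<chi> (\<pi> v)"] exI[of _ "Suc m"]) auto
    next
      \<comment> \<open>A common parent: separate \<open>a0\<close> from the rest. Two edges through
        the parent join any two vertices of \<open>X\<close>, whence \<open>m = 1\<close>.\<close>
      case False
      obtain a0 b0 where ab0: "a0 \<in> X" "b0 \<in> X" "a0 \<noteq> b0" using two by blast
      have "linked 1 (Lo \<union> K) N a b"
        if ab: "a \<in> X" "b \<in> X" "(a = a0) \<noteq> (b = a0)" for a b
      proof -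
        have ne: "a \<noteq> b" using ab by auto
        have eq: "\<pi> a = \<pi> b" using False ab by blast
        have "lpath \<pi>a [t b] b" if "\<pi>a = \<pi> b" for \<pi>a
          using t[OF ab(2)] x\<pi>[OF ab(2)] that by auto
        then have "lpath a [t a, t b] b"
          using t[OF ab(1)] x\<pi>[OF ab(1)] tt[OF ab(1,2) ne] eq
          unfolding lpath.simps(2)[of a "t a"] by (intro exI[of _ "\<pi> a"]) auto
        then show ?thesis
          using blk[OF ab(1)] blk[OF ab(2)] tE[OF ab(1)] tE[OF ab(2)]
          by (intro linkedI[of a "[t a, t b]"]) auto
      qed
      moreover have "\<exists>a\<in>X. \<exists>b\<in>X. (a = a0) \<noteq> (b = a0)"
        by (rule bexI[OF bexI[OF _ ab0(2)] ab0(1)]) (use ab0(3) in simp)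
      ultimately show ?thesis
        by (intro exI[of _ "\<lambda>v. v = a0"] exI[of _ 1]) simp
    qed
  qed
  show ?thesis
    unfolding level_def
  proof (intro conjI ballI impI)
    show "(Lo \<union> K) \<inter> (\<Union>N - K) = {}" using N(2) by blast
    show "e \<inter> (Lo \<union> K) \<noteq> {}" if "e \<in> N" for e using N(3)[OF that] by blast
    show "e \<subseteq> Lo \<union> K \<union> (\<Union>N - K)" if "e \<in> N" for e using that by blast
    show "e \<inter> f \<subseteq> Lo \<union> K" if "e \<in> N" "f \<in> N" "e \<noteq> f" for e f using N(4)[OF that] by blast
  qed (use finN N(1) sp in auto)
qed

section \<open>Greedy paths and the cycle in the dense case\<close>

text \<open>A vertex outside \<open>Lo\<close> lies on at most one edge of \<open>M\<close>, so it
  contributes itself and at most \<open>r\<close> vertices of that edge.\<close>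

lemma card_spread_le:
  assumes M: "M \<subseteq> E" "\<And>e f. e \<in> M \<Longrightarrow> f \<in> M \<Longrightarrow> e \<noteq> f \<Longrightarrow> e \<inter> f \<subseteq> Lo"
    and S: "finite S" "S \<inter> Lo = {}"
  shows "finite (spread M S) \<and> card (spread M S) \<le> (r + 1) * card S"
proof -
  have b: "finite (blk M u) \<and> card (blk M u) \<le> r" if "u \<in> S" for u
  proof (cases "\<exists>e\<in>M. u \<in> e")
    case True
    then obtain e where e: "e \<in> M" "u \<in> e" by blast
    then have "{e \<in> M. u \<in> e} = {e}" using M(2) S(2) that by blast
    then have "blk M u = e" by (simp add: blk_def)
    moreover have "e \<in> E" using e M(1) by blast
    ultimately show ?thesis using card_edge finite_edge by simp
  next
    case False
    then have "blk M u = {}" unfolding blk_def by blast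
    then show ?thesis by simp
  qed
  have "card (\<Union>u\<in>S. blk M u) \<le> (\<Sum>u\<in>S. card (blk M u))" by (rule card_UN_le[OF S(1)])
  also have "\<dots> \<le> r * card S" using sum_bounded_above[of S "\<lambda>u. card (blk M u)" r] b by (simp add: mult.commute)
  finally have "card (spread M S) \<le> card S + r * card S"
    unfolding spread_def using card_Un_le[of S "\<Union>u\<in>S. blk M u"] by linarith
  then show ?thesis using b S(1) by (simp add: spread_def)
qed

text \<open>Avoiding \<open>Lo\<close>, the edge \<open>f\<close> is not in \<open>M\<close>;
  linearity then leaves one common vertex with each top edge through \<open>v\<close>.\<close>

lemma Int_blk:
  assumes "M \<subseteq> E" "\<And>e. e \<in> M \<Longrightarrow> e \<inter> Lo \<noteq> {}" "f \<in> E" "f \<inter> Lo = {}" "v \<in> f"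
  shows "f \<inter> blk M v \<subseteq> {v}"
proof
  fix u assume "u \<in> f \<inter> blk M v"
  then obtain e where e: "e \<in> M" "v \<in> e" "u \<in> e" "u \<in> f" unfolding blk_def by blast
  then have "e \<noteq> f" using assms by blast
  then show "u \<in> {v}" using edge_eqI[of e f u v] e assms by blast
qed

lemma spread_mono: "S \<subseteq> T \<Longrightarrow> spread M S \<subseteq> spread M T"
  unfolding spread_def by blast

lemma subset_spread: "S \<subseteq> spread M S"
  unfolding spread_def by blast

lemma disjoint_blk_of_notin_spread: "v \<notin> spread M S \<Longrightarrow> S \<inter> blk M v = {}"
  unfolding spread_def blk_def by blast

text \<open>A greedy walk in the bipartite graph joining \<open>x f\<close> to \<open>y f\<close>.
  The parity of \<open>n\<close> fixes the starting side so that the walk ends on the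
  \<open>x\<close> side. The bound on \<open>s\<close> allows for the \<open>r\<close> vertices that
  each step adds to the forbidden set; the last clause lets the walk continue into the tree at
  \<open>v\<close>.\<close>

lemma greedy_path:
  assumes M: "M \<subseteq> E" "\<And>e. e \<in> M \<Longrightarrow> e \<inter> Lo \<noteq> {}"
      "\<And>e f. e \<in> M \<Longrightarrow> f \<in> M \<Longrightarrow> e \<noteq> f \<Longrightarrow> e \<inter> f \<subseteq> Lo"
    and F: "F \<subseteq> E" "\<And>f. f \<in> F \<Longrightarrow> f \<inter> Lo = {}"
      "\<And>f. f \<in> F \<Longrightarrow> x f \<in> f \<and> y f \<in> f \<and> x f \<noteq> y f"
    and deg: "\<And>f. f \<in> F \<Longrightarrow> s < card {g \<in> F. x g = x f}"
      "\<And>f. f \<in> F \<Longrightarrow> s < card {g \<in> F. y g = y f}"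
    and start: "if even n then u \<in> x ` F else u \<in> y ` F"
    and S: "finite S" "S \<inter> Lo = {}" "(r + 1) * (card S + r * n) \<le> s"
  shows "\<exists>R v. lpath u R v \<and> length R = n \<and> set R \<subseteq> F \<and> v \<in> x ` F \<and>
    \<Union>(set R) \<inter> spread M S \<subseteq> {u} \<and> (0 < n \<longrightarrow> v \<notin> spread M S) \<and> \<Union>(set R) \<inter> blk M v \<subseteq> {v}"
  using start S
proof (induction n arbitrary: u S)
  case 0
  then show ?case by (intro exI[of _ "[]"] exI[of _ u]) simp
next
  case (Suc n)
  have "\<exists>G. G \<subseteq> F \<and> s < card G \<and>
      (\<forall>g\<in>G. u \<in> g \<and> (\<exists>z\<in>g. z \<noteq> u \<and> (if even n then z \<in> x ` F else z \<in> y ` F)))"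
  proof (cases "even n")
    case True
    then obtain f where f: "f \<in> F" "u = y f" using Suc.prems(1) by auto
    have "u \<in> g \<and> (\<exists>z\<in>g. z \<noteq> u \<and> z \<in> x ` F)" if "g \<in> F" "y g = u" for g
      using F(3)[OF that(1)] that by blast
    then show ?thesis
      using deg(2)[OF f(1)] True unfolding f(2)[symmetric]
      by (intro exI[of _ "{g \<in> F. y g = u}"]) simp
  next
    case False
    then obtain f where f: "f \<in> F" "u = x f" using Suc.prems(1) by auto
    have "u \<in> g \<and> (\<exists>z\<in>g. z \<noteq> u \<and> z \<in> y ` F)" if "g \<in> F" "x g = u" for g
      using F(3)[OF that(1)] that by force
    then show ?thesis
      using deg(1)[OF f(1)] False unfolding f(2)[symmetric]
      by (intro exI[of _ "{g \<in> F. x g = u}"]) simp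
  qed
  then obtain G where G: "G \<subseteq> F" "s < card G"
    "\<And>g. g \<in> G \<Longrightarrow> u \<in> g \<and> (\<exists>z\<in>g. z \<noteq> u \<and> (if even n then z \<in> x ` F else z \<in> y ` F))"
    by blast
  note sp = card_spread_le[OF M(1,3) Suc.prems(2,3)]
  have "(r + 1) * card S \<le> (r + 1) * (card S + r * Suc n)"
    by (intro mult_le_mono2) simp
  then have "card (spread M S) < card G"
    using sp G(2) Suc.prems(4) by linarith
  then obtain g where g: "g \<in> G" "g \<inter> spread M S \<subseteq> {u}"
    using ex_edge_avoiding[of G u "spread M S"] sp G F(1) by blast
  have gF: "g \<in> F" "g \<in> E" "g \<inter> Lo = {}" using g G F by blast+
  obtain z where z: "z \<in> g" "z \<noteq> u" "if even n then z \<in> x ` F else z \<in> y ` F"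
    using G(3)[OF g(1)] by blast
  have ug: "u \<in> g" using G(3)[OF g(1)] by blast
  have "card (S \<union> g) \<le> card S + r"
    using card_Un_le[of S g] card_edge[OF gF(2)] by simp
  then have "(r + 1) * (card (S \<union> g) + r * n) \<le> (r + 1) * (card S + r * Suc n)"
    by (intro mult_le_mono2) simp
  then have le: "(r + 1) * (card (S \<union> g) + r * n) \<le> s" using Suc.prems(4) by linarith
  \<comment> \<open>The rest of the path treats all of \<open>g\<close> as forbidden, so it meets
    \<open>g\<close> only in \<open>z\<close>.\<close>
  obtain R v where R: "lpath z R v" "length R = n" "set R \<subseteq> F" "v \<in> x ` F"
    "\<Union>(set R) \<inter> spread M (S \<union> g) \<subseteq> {z}" "0 < n \<longrightarrow> v \<notin> spread M (S \<union> g)"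
    "\<Union>(set R) \<inter> blk M v \<subseteq> {v}"
    using Suc.IH[OF z(3) _ _ le] Suc.prems(2,3) finite_edge[OF gF(2)] gF(3) by blast
  have zS: "z \<notin> spread M S" using g(2) z by blast
  have gR: "g \<inter> \<Union>(set R) \<subseteq> {z}"
    using R(5) subset_spread[of "S \<union> g" M] by blast
  have SR: "\<Union>(set R) \<inter> spread M S = {}"
    using R(5) spread_mono[of S "S \<union> g" M] zS by blast
  \<comment> \<open>If \<open>g\<close> is the last edge, \<open>v = z\<close> lies on it and
    linearity applies; otherwise \<open>v\<close> was chosen so that its top edge misses
    \<open>g\<close>.\<close>
  have v: "v \<notin> spread M S \<and> g \<inter> blk M v \<subseteq> {v}"
  proof (cases "n = 0")
    case True
    then have "v = z" using R(1,2) by simp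
    then show ?thesis using zS Int_blk[OF M(1,2) gF(2,3) z(1)] by blast
  next
    case False
    then have "v \<notin> spread M (S \<union> g)" using R(6) by simp
    then show ?thesis
      using spread_mono[of S "S \<union> g" M] disjoint_blk_of_notin_spread[of v M "S \<union> g"] by blast
  qed
  have "lpath u (g # R) v"
    using ug z R(1) gR unfolding lpath.simps(2) by (intro exI[of _ z]) simp
  moreover have "\<Union>(set (g # R)) \<inter> spread M S \<subseteq> {u}" using g(2) SR by auto
  moreover have "\<Union>(set (g # R)) \<inter> blk M v \<subseteq> {v}" using v R(7) by auto
  ultimately show ?case using R v gF by (intro exI[of _ "g # R"] exI[of _ v]) simp
qed

text \<open>In a subgraph of large minimum degree, some \<open>y\<close>-vertex has neighbours of
  both colours given by \<open>splits\<close>. A greedy path from it ends at a top vertex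
  \<open>v\<close>; the neighbour coloured unlike \<open>v\<close> closes the cycle through the
  tree.\<close>

lemma has_lcycle_of_dense:
  assumes lev: "level j Lo K M" and jk: "j < k"
    and F: "F \<subseteq> E" "\<And>f. f \<in> F \<Longrightarrow> f \<inter> Lo = {}"
      "\<And>f. f \<in> F \<Longrightarrow> x f \<in> f \<and> x f \<in> K \<and> c (x f) = q"
      "\<And>f. f \<in> F \<Longrightarrow> y f \<in> f \<and> y f \<noteq> x f \<and> y f \<in> Y"
    and Y: "finite Y"
    and dense: "r * (r + 1) * (2 * k + 1) * (card {v \<in> K. c v = q} + card Y) < card F"
  shows "has_lcycle E (2 * k)"
proof -
  \<comment> \<open>The budget of \<open>greedy_path\<close> for fewer than \<open>2 * k\<close>
    edges avoiding two given ones: \<open>2 * r + r * (2 * k - 1)\<close> vertices, times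
    \<open>r + 1\<close>.\<close>
  let ?s = "r * (r + 1) * (2 * k + 1)"
  have M: "M \<subseteq> E" "\<And>e. e \<in> M \<Longrightarrow> e \<inter> Lo \<noteq> {}"
      "\<And>e f. e \<in> M \<Longrightarrow> f \<in> M \<Longrightarrow> e \<noteq> f \<Longrightarrow> e \<inter> f \<subseteq> Lo" and "finite K"
    using lev unfolding level_def by blast+
  have finF: "finite F" using F(1) finite_E finite_subset by blast
  \<comment> \<open>Edges are rainbow, so the two sides of the auxiliary graph are disjoint.\<close>
  have cy: "c (y f) \<noteq> q" if "f \<in> F" for f
    using same_class_eqI[of f "x f" "y f"] F(1) F(3)[OF that] F(4)[OF that] that by auto
  define good where "good F' \<longleftrightarrow> F' \<subseteq> F \<and> F' \<noteq> {} \<and>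
    (\<forall>f\<in>F'. ?s < card {g \<in> F'. x g = x f} \<and> ?s < card {g \<in> F'. y g = y f})" for F'
  have "?s * card ({v \<in> K. c v = q} \<union> Y) \<le> ?s * (card {v \<in> K. c v = q} + card Y)"
    by (intro mult_le_mono2 card_Un_le)
  then have "?s * card ({v \<in> K. c v = q} \<union> Y) < card F" using dense by (rule le_less_trans)
  then have "\<exists>F'. F' \<subseteq> F \<and> F' \<noteq> {} \<and>
      (\<forall>f\<in>F'. \<forall>v\<in>{x f, y f}. ?s < card {g \<in> F'. v \<in> {x g, y g}})"
    using F(3,4) Y \<open>finite K\<close> finF
    by (intro ex_large_min_degree[of "{v \<in> K. c v = q} \<union> Y"]) auto
  then obtain F' where F': "F' \<subseteq> F" "F' \<noteq> {}"
    "\<And>f v. f \<in> F' \<Longrightarrow> v \<in> {x f, y f} \<Longrightarrow> ?s < card {g \<in> F'. v \<in> {x g, y g}}"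
    by blast
  have "good F'"
    unfolding good_def
  proof (intro conjI ballI F'(1,2))
    fix f assume f: "f \<in> F'"
    have "{g \<in> F'. x f \<in> {x g, y g}} = {g \<in> F'. x g = x f}"
      "{g \<in> F'. y f \<in> {x g, y g}} = {g \<in> F'. y g = y f}"
      using cy F(3) F'(1) f by (auto, metis subsetD, metis subsetD)
    then show "?s < card {g \<in> F'. x g = x f}" "?s < card {g \<in> F'. y g = y f}"
      using F'(3)[OF f, of "x f"] F'(3)[OF f, of "y f"] by simp_all
  qed
  then obtain H where H: "good H" and minimal: "\<And>H'. good H' \<Longrightarrow> card H \<le> card H'"
    using ex_has_least_nat[of good F' card] by blast
  have HF: "H \<subseteq> F" "H \<noteq> {}" "H \<subseteq> E" "finite H"
    and deg: "\<And>f. f \<in> H \<Longrightarrow> ?s < card {g \<in> H. x g = x f}"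
      "\<And>f. f \<in> H \<Longrightarrow> ?s < card {g \<in> H. y g = y f}"
    using H finF F(1) unfolding good_def by (auto intro: finite_subset)
  \<comment> \<open>Two edges at the same \<open>y\<close>-vertex have different
    \<open>x\<close>-vertices by linearity.\<close>
  have "\<exists>a\<in>x ` H. \<exists>b\<in>x ` H. a \<noteq> b"
  proof -
    obtain f where f: "f \<in> H" using HF(2) by blast
    have "1 \<le> ?s" using r_ge by simp
    then have "1 < card {g \<in> H. y g = y f}" using deg(2)[OF f] by linarith
    then have "\<not> {g \<in> H. y g = y f} \<subseteq> {f}"
      using card_mono[of "{f}" "{g \<in> H. y g = y f}"] by auto
    then obtain g where g: "g \<in> H" "y g = y f" "g \<noteq> f" by blast
    have "x g \<noteq> x f"
    proof
      assume "x g = x f"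
      have gf: "g \<in> F" "f \<in> F" "g \<in> E" "f \<in> E" using g f HF by blast+
      have "g = f"
        by (rule edge_eqI[of g f "x f" "y f"])
          (use gf F(3)[OF gf(1)] F(3)[OF gf(2)] F(4)[OF gf(1)] F(4)[OF gf(2)] g(2) \<open>x g = x f\<close> in auto)
      then show False using g(3) by simp
    qed
    then show ?thesis using f g by blast
  qed
  moreover have "x ` H \<subseteq> {v \<in> K. c v = q}" using F(3) HF(1) by blast
  moreover have "splits j Lo K M" using lev unfolding level_def by blast
  ultimately obtain \<chi> :: "'a \<Rightarrow> bool" and m where m: "1 \<le> m" "m \<le> j"
    "\<exists>a\<in>x ` H. \<exists>b\<in>x ` H. \<chi> a \<noteq> \<chi> b"
    and conn: "\<And>a b. a \<in> x ` H \<Longrightarrow> b \<in> x ` H \<Longrightarrow> \<chi> a \<noteq> \<chi> b \<Longrightarrow> linked m Lo M a b"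
    by - (rule splitsE[of j Lo K M "x ` H" q], assumption+, rule that, assumption+)
  text \<open>Minimality of \<open>H\<close> plays the role of connectedness.\<close>
  have "\<exists>fa\<in>H. \<exists>fb\<in>H. y fa = y fb \<and> \<chi> (x fa) \<noteq> \<chi> (x fb)"
  proof (rule ccontr)
    assume no: "\<not> ?thesis"
    \<comment> \<open>If no \<open>y\<close>-vertex sees both colours, the edges of one colour keep
      all their degrees and form a smaller good subgraph.\<close>
    let ?H = "{f \<in> H. \<chi> (x f)}"
    have same: "\<chi> (x g) = \<chi> (x h)" if "g \<in> H" "h \<in> H" "y g = y h" for g h
      using no that by metis
    have "good ?H"
      unfolding good_def
    proof (intro conjI ballI)
      show "?H \<subseteq> F" using HF(1) by blast
      show "?H \<noteq> {}" using m(3) by fast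
      fix f assume f: "f \<in> ?H"
      have "{g \<in> ?H. x g = x f} = {g \<in> H. x g = x f}"
        using f by auto
      then show "?s < card {g \<in> ?H. x g = x f}" using deg(1)[of f] f by simp
      have "{g \<in> ?H. y g = y f} = {g \<in> H. y g = y f}"
        using f same by blast
      then show "?s < card {g \<in> ?H. y g = y f}" using deg(2)[of f] f by simp
    qed
    then have "card H \<le> card ?H" by (rule minimal)
    moreover have "?H \<subset> H" using m(3) by fast
    ultimately show False
      using psubset_card_mono[OF HF(4)] by (meson not_le)
  qed
  then obtain fa fb where f: "fa \<in> H" "fb \<in> H" "y fa = y fb" "\<chi> (x fa) \<noteq> \<chi> (x fb)" by blast
  have HLo: "h \<inter> Lo = {}" if "h \<in> H" for h using F(2) HF(1) that by blast
  \<comment> \<open>Odd, so the path goes from the \<open>y\<close> side to the \<open>x\<close>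
    side. With \<open>fd\<close> it has \<open>2 * (k - m)\<close> edges, and the tree supplies the
    other \<open>2 * m\<close>.\<close>
  let ?n = "2 * (k - m) - 1" and ?S = "fa \<union> fb"
  have n: "odd ?n" "0 < ?n" "Suc ?n = 2 * (k - m)" "?n + 2 \<le> 2 * k + 1"
    using m jk by auto
  have "card ?S \<le> 2 * r" using card_Un_le[of fa fb] card_edge f HF(3) by (metis mult_2 subsetD)
  then have "card ?S + r * ?n \<le> r * (?n + 2)" by (simp add: algebra_simps)
  also have "\<dots> \<le> r * (2 * k + 1)" by (intro mult_le_mono2 n(4))
  finally have "(r + 1) * (card ?S + r * ?n) \<le> (r + 1) * (r * (2 * k + 1))"
    by (rule mult_le_mono2)
  then have le: "(r + 1) * (card ?S + r * ?n) \<le> ?s" by (simp only: ac_simps)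
  have xy: "x h \<in> h \<and> y h \<in> h \<and> x h \<noteq> y h" if "h \<in> H" for h
    using F(3,4) HF(1) that by (metis subsetD)
  have Sfin: "finite ?S" "?S \<inter> Lo = {}" using f HF(3) finite_edge HLo by blast+
  have st: "if even ?n then y fa \<in> x ` H else y fa \<in> y ` H" using n(1) f by simp
  obtain R v where R: "lpath (y fa) R v" "length R = ?n" "set R \<subseteq> H" "v \<in> x ` H"
    "\<Union>(set R) \<inter> spread M ?S \<subseteq> {y fa}" "v \<notin> spread M ?S" "\<Union>(set R) \<inter> blk M v \<subseteq> {v}"
    using greedy_path[OF M HF(3) HLo xy deg st Sfin le] n(2) by blast
  \<comment> \<open>\<open>fa\<close> and \<open>fb\<close> have \<open>x\<close>-ends of different
    colours, so one of them differs from \<open>v\<close>.\<close>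
  obtain fd where fd: "fd \<in> {fa, fb}" "\<chi> v \<noteq> \<chi> (x fd)" using f(4) by blast
  have fdH: "fd \<in> H" "y fd = y fa" "fd \<subseteq> ?S" "fd \<in> E" using fd f HF(3) by auto
  obtain es where es: "lpath v es (x fd)" "length es = 2 * m" "set es \<subseteq> E"
    "\<Union>(set es) \<subseteq> Lo \<union> blk M v \<union> blk M (x fd)"
    by (rule linkedE[OF conn[OF R(4) imageI[OF fdH(1)] fd(2)]])
  have sS: "?S \<subseteq> spread M ?S" by (rule subset_spread)
  have 1: "fd \<inter> \<Union>(set R) \<subseteq> {y fa}" using R(5) sS fdH(3) by blast
  have P: "lpath (x fd) (fd # R) v"
    using xy[OF fdH(1)] fdH(2) R(1) 1 unfolding lpath.simps(2) by (intro exI[of _ "y fa"]) simp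
  have PQ: "\<Union>(set (fd # R)) \<inter> \<Union>(set es) \<subseteq> {x fd, v}"
  proof -
    define A where "A = \<Union>(set R)"
    note R' = R(5,7)[folded A_def]
    have lo: "fd \<inter> Lo = {}" "A \<inter> Lo = {}" using HLo R(3) fdH(1) unfolding A_def by blast+
    have a: "fd \<inter> blk M (x fd) \<subseteq> {x fd}"
      using Int_blk[OF M(1,2) fdH(4) HLo[OF fdH(1)]] xy[OF fdH(1)] by blast
    have b: "fd \<inter> blk M v = {}"
      using disjoint_blk_of_notin_spread[OF R(6)] fdH(3) by blast
    \<comment> \<open>The top edge of \<open>x fd\<close> lies in the spread, which the path meets
      at most in \<open>y fd\<close>; that vertex is not on this top edge.\<close>
    have c: "A \<inter> blk M (x fd) = {}"
    proof -
      have "blk M (x fd) \<subseteq> spread M ?S"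
        using xy[OF fdH(1)] fdH(3) unfolding spread_def by blast
      moreover have "y fd \<notin> blk M (x fd)" using a xy[OF fdH(1)] by auto
      ultimately show ?thesis using R'(1) fdH(2) by auto
    qed
    have "(fd \<union> A) \<inter> (Lo \<union> blk M v \<union> blk M (x fd)) \<subseteq> {x fd, v}"
      using lo a b c R'(2) by blast
    moreover have "\<Union>(set (fd # R)) = fd \<union> A" by (simp add: A_def)
    ultimately show ?thesis using es(4) by auto
  qed
  have E: "set (fd # R) \<union> set es \<subseteq> E" using fdH(4) R(3) HF(3) es(3) by auto
  have len: "2 \<le> length (fd # R)" "2 \<le> length es" "length (fd # R) + length es = 2 * k"
    using R(2) es(2) n m jk by auto
  show ?thesis
    unfolding has_lcycle_def
    by (intro exI[of _ "x fd"] exI[of _ v] exI[of _ "fd # R"] exI[of _ es] conjI P es(1) E PQ len)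
qed

section \<open>Growth of the layers\<close>

definition touching :: "'a set \<Rightarrow> 'a set \<Rightarrow> nat \<Rightarrow> 'a set set" where
  "touching Lo K q = {e \<in> E. e \<inter> Lo = {} \<and> (\<exists>v\<in>e \<inter> K. c v = q)}"

text \<open>The edge sets that \<open>level_Suc\<close> accepts as new top edges.\<close>

definition family :: "'a set \<Rightarrow> 'a set \<Rightarrow> nat \<Rightarrow> 'a set set \<Rightarrow> bool" where
  "family Lo K q N \<longleftrightarrow> N \<subseteq> E \<and> (\<forall>e\<in>N. e \<inter> Lo = {} \<and> (\<exists>v. e \<inter> K = {v} \<and> c v = q)) \<and>
     (\<forall>e\<in>N. \<forall>f\<in>N. e \<noteq> f \<longrightarrow> e \<inter> f \<subseteq> K)"

lemma familyD:
  assumes "family Lo K q N"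
  shows "N \<subseteq> E" and "\<And>e. e \<in> N \<Longrightarrow> e \<inter> Lo = {}"
    and "\<And>e. e \<in> N \<Longrightarrow> \<exists>v. e \<inter> K = {v} \<and> c v = q"
    and "\<And>e f. e \<in> N \<Longrightarrow> f \<in> N \<Longrightarrow> e \<noteq> f \<Longrightarrow> e \<inter> f \<subseteq> K"
proof -
  show "N \<subseteq> E" using assms unfolding family_def by (elim conjE)
  show "e \<inter> Lo = {}" "\<exists>v. e \<inter> K = {v} \<and> c v = q" if "e \<in> N" for e
    using assms that unfolding family_def by simp_all
  show "e \<inter> f \<subseteq> K" if "e \<in> N" "f \<in> N" "e \<noteq> f" for e f
    using assms that unfolding family_def by simp
qed

lemma ex_maximal_family:
  "\<exists>N. family Lo K q N \<and> (\<forall>e. family Lo K q (insert e N) \<longrightarrow> e \<in> N)"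
proof -
  have "family Lo K q {}" unfolding family_def by blast
  moreover have bound: "card N < Suc (card E)" if "family Lo K q N" for N
    using that card_mono[OF finite_E] unfolding family_def by (simp add: less_Suc_eq_le)
  ultimately obtain N where N: "family Lo K q N" "\<And>N'. family Lo K q N' \<Longrightarrow> card N' \<le> card N"
    using ex_has_greatest_nat[of "family Lo K q" "{}" card "Suc (card E)"] by blast
  have "finite N" using familyD(1)[OF N(1)] finite_E by (rule finite_subset)
  then have "e \<in> N" if "family Lo K q (insert e N)" for e
    using N(2)[OF that] by (cases "e \<in> N") auto
  then show ?thesis using N(1) by blast
qed

text \<open>By maximality a touching edge outside \<open>N\<close> has a second vertex in
  \<open>K\<close> or on \<open>N\<close>; otherwise it could be inserted. These edges form a
  bipartite graph to which \<open>has_lcycle_of_dense\<close> applies.\<close>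

lemma card_touching_le:
  assumes lev: "level j Lo K M" and jk: "j < k" and nocyc: "\<not> has_lcycle E (2 * k)"
    and N: "family Lo K q N" and max: "\<And>e. family Lo K q (insert e N) \<Longrightarrow> e \<in> N"
    and \<mu>: "\<And>q. card {v \<in> K. c v = q} \<le> \<mu>" and \<mu>': "card N \<le> \<mu>'"
  shows "card (touching Lo K q) \<le> (1 + r * (r + 1) * (2 * k + 1) * (r + 1)) * (\<mu> + \<mu>')"
proof -
  let ?s = "r * (r + 1) * (2 * k + 1)"
  have finK: "finite K" using lev unfolding level_def by blast
  note NE = familyD(1)[OF N] and N2 = familyD(2-)[OF N]
  have finN: "finite N" using NE finite_E by (rule finite_subset)
  define F where "F = touching Lo K q - N"
  define Y where "Y = K \<union> \<Union>N"
  have "\<exists>u v. u \<in> f \<and> u \<in> K \<and> c u = q \<and> v \<in> f \<and> v \<noteq> u \<and> v \<in> Y" if f: "f \<in> F" for f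
  proof -
    obtain u where u: "u \<in> f" "u \<in> K" "c u = q" and fE: "f \<in> E" "f \<inter> Lo = {}" and fN: "f \<notin> N"
      using f unfolding F_def touching_def by blast
    have "\<exists>v. v \<in> f \<and> v \<noteq> u \<and> v \<in> Y"
    proof (rule ccontr)
      assume no: "\<not> ?thesis"
      have fK: "f \<inter> K = {u}" using no u unfolding Y_def by blast
      have "f \<inter> e \<subseteq> K" if "e \<in> N" for e
        using no that u(2) unfolding Y_def by blast
      then have "family Lo K q (insert f N)"
        using NE N2 fE fK u(3) unfolding family_def by auto
      then show False using max fN by blast
    qed
    then show ?thesis using u by blast
  qed
  then obtain x y where xy: "\<And>f. f \<in> F \<Longrightarrow> x f \<in> f \<and> x f \<in> K \<and> c (x f) = q"
      "\<And>f. f \<in> F \<Longrightarrow> y f \<in> f \<and> y f \<noteq> x f \<and> y f \<in> Y"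
    by metis
  have F: "F \<subseteq> E" "\<And>f. f \<in> F \<Longrightarrow> f \<inter> Lo = {}" unfolding F_def touching_def by blast+
  have finY: "finite Y" using finK finN NE finite_edge unfolding Y_def by blast
  have cF: "card F \<le> ?s * (card {v \<in> K. c v = q} + card Y)"
    using has_lcycle_of_dense[OF lev jk F xy finY] nocyc by (meson not_le)
  have "card (\<Union>N) \<le> (\<Sum>e\<in>N. card e)" by (rule card_Union_le_sum_card)
  also have "\<dots> = r * card N" using NE card_edge by (simp add: subset_iff mult.commute)
  finally have UN: "card (\<Union>N) \<le> r * \<mu>'" using \<mu>' by (meson le_trans mult_le_mono2)
  have "K = (\<Union>q<r. {v \<in> K. c v = q})" using c_less by auto
  then have "card K \<le> (\<Sum>q<r. card {v \<in> K. c v = q})"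
    using card_UN_le[of "{..<r}" "\<lambda>q. {v \<in> K. c v = q}"] by simp
  also have "\<dots> \<le> r * \<mu>" using sum_bounded_above[of "{..<r}" "\<lambda>q. card {v \<in> K. c v = q}" \<mu>] \<mu> by simp
  finally have "card Y \<le> r * \<mu> + r * \<mu>'" using UN card_Un_le[of K "\<Union>N"] unfolding Y_def by linarith
  \<comment> \<open>\<open>r\<close> classes of \<open>K\<close> and the edges of \<open>N\<close>
    bound \<open>card Y\<close>; the class of the \<open>x\<close>-vertices adds one more
    \<open>\<mu>\<close>, hence the factor \<open>r + 1\<close>.\<close>
  then have "card {v \<in> K. c v = q} + card Y \<le> (r + 1) * (\<mu> + \<mu>')"
    using \<mu>[of q] by (simp add: algebra_simps)
  then have "card F \<le> ?s * ((r + 1) * (\<mu> + \<mu>'))"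
    using cF by (meson le_trans mult_le_mono2)
  moreover have "card (touching Lo K q) \<le> card F + card N"
    using card_mono[of "F \<union> N" "touching Lo K q"] card_Un_le[of F N] finN F(1) finite_E finite_subset
    unfolding F_def by fastforce
  ultimately have "card (touching Lo K q) \<le> ?s * ((r + 1) * (\<mu> + \<mu>')) + (\<mu> + \<mu>')"
    using \<mu>' by linarith
  also have "\<dots> = (1 + ?s * (r + 1)) * (\<mu> + \<mu>')" by (simp add: algebra_simps)
  finally show ?thesis .
qed

text \<open>Each edge of \<open>N\<close> has one vertex in every class. The one of class
  \<open>p\<close> is in \<open>K\<close>, the others are new and belong to no second edge of
  \<open>N\<close>.\<close>

lemma card_new_class:
  assumes N: "family Lo K p N"
  shows "card {v \<in> \<Union>N - K. c v = q} \<le> card N"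
    and "q \<noteq> p \<Longrightarrow> q < r \<Longrightarrow> card {v \<in> \<Union>N - K. c v = q} = card N"
proof -
  note NE = familyD(1)[OF N] and N2 = familyD(3-)[OF N]
  have finN: "finite N" using NE finite_E by (rule finite_subset)
  let ?Q = "{v \<in> \<Union>N - K. c v = q}"
  have "\<forall>v\<in>?Q. \<exists>e. e \<in> N \<and> v \<in> e" by blast
  then obtain t where t: "\<And>v. v \<in> ?Q \<Longrightarrow> t v \<in> N \<and> v \<in> t v" by metis
  have "inj_on t ?Q"
  proof (rule inj_onI)
    fix u v assume uv: "u \<in> ?Q" "v \<in> ?Q" "t u = t v"
    show "u = v"
    proof (rule same_class_eqI)
      show "t u \<in> E" "u \<in> t u" "v \<in> t u" "c u = c v" using t[OF uv(1)] t[OF uv(2)] uv NE by auto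
    qed
  qed
  then show le: "card ?Q \<le> card N" using t finN by (intro card_inj_on_le[of t]) auto
  assume q: "q \<noteq> p" "q < r"
  have "\<exists>v. v \<in> e \<and> v \<in> ?Q" if e: "e \<in> N" for e
  proof -
    have eE: "e \<in> E" using e NE by blast
    have "c ` e = {..<r}"
      using c_less card_image[OF inj_c[OF eE]] card_edge[OF eE] by (intro card_subset_eq) auto
    then obtain v where v: "v \<in> e" "c v = q" using q(2) by (metis imageE lessThan_iff)
    moreover have "v \<notin> K"
    proof
      assume "v \<in> K"
      moreover obtain w where "e \<inter> K = {w}" "c w = p" using N2(1)[OF e] by (elim exE conjE)
      ultimately show False using v q(1) by auto
    qed
    ultimately show ?thesis using e by blast
  qed
  then obtain z where z: "\<And>e. e \<in> N \<Longrightarrow> z e \<in> e \<and> z e \<in> ?Q" by metis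
  have "inj_on z N"
  proof (rule inj_onI)
    fix e f assume "e \<in> N" "f \<in> N" "z e = z f"
    then show "e = f" using N2(2)[of e f] z[of e] z[of f] by auto
  qed
  moreover have "finite (\<Union>N)" using finN NE finite_edge by blast
  then have "finite ?Q" by (rule rev_finite_subset) blast
  ultimately have "card N \<le> card ?Q" using z by (intro card_inj_on_le[of z]) auto
  then show "card ?Q = card N" using le by simp
qed

section \<open>Induction on the height of the tree\<close>

text \<open>Layers are measured by their largest class, as only one class gets children. The last
  clause carries along the edges meeting older layers, which \<open>touching\<close> leaves
  out.\<close>

definition layer :: "nat \<Rightarrow> nat \<Rightarrow> nat \<Rightarrow> 'a set \<Rightarrow> 'a set \<Rightarrow> 'a set set \<Rightarrow> nat \<Rightarrow> bool" where
  "layer b D j Lo K M \<mu> \<longleftrightarrow> level j Lo K M \<and> K \<subseteq> \<Union>E \<and> D ^ j \<le> \<mu> \<and>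
    (\<forall>q. card {v \<in> K. c v = q} \<le> \<mu>) \<and> (\<exists>q. card {v \<in> K. c v = q} = \<mu>) \<and>
    card {e \<in> E. e \<inter> Lo \<noteq> {}} \<le> 2 * b * \<mu>"

text \<open>Count the edges meeting \<open>Lo \<union> K\<close>. Degrees at a largest class give at
  least \<open>b * (D + 3) * \<mu>\<close>; the invariant and \<open>card_touching_le\<close>,
  summed over \<open>r\<close> classes, give at most \<open>b * (3 * \<mu> + \<mu>')\<close>, with
  \<open>\<mu>'\<close> the size of the largest family. Hence
  \<open>D * \<mu> \<le> \<mu>'\<close>.\<close>

lemma ex_layer:
  fixes k :: nat
  defines "b \<equiv> r * (1 + r * (r + 1) * (2 * k + 1) * (r + 1))"
  assumes nocyc: "\<not> has_lcycle E (2 * k)" and ne: "E \<noteq> {}" and D: "3 \<le> D"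
    and deg: "\<And>v. v \<in> \<Union>E \<Longrightarrow> b * (D + 3) \<le> card {e \<in> E. v \<in> e}"
    and j: "j \<le> k"
  shows "\<exists>Lo K M \<mu>. layer b D j Lo K M \<mu>"
  using j
proof (induction j)
  case 0
  obtain e where e: "e \<in> E" using ne by blast
  then obtain v where v: "v \<in> e" using card_edge[OF e] r_ge by fastforce
  have "layer b D 0 {} {v} {} 1"
    unfolding layer_def
  proof (intro conjI allI exI[of _ "c v"])
    show "card {u \<in> {v}. c u = q} \<le> 1" for q
      by (rule order_trans[OF card_mono[of "{v}"]]) auto
    have "{u \<in> {v}. c u = c v} = {v}" by auto
    then show "card {u \<in> {v}. c u = c v} = 1" by simp
  qed (use level_0 e v in auto)
  then show ?case by blast
next
  case (Suc j)
  then obtain Lo K M \<mu> where lay: "layer b D j Lo K M \<mu>" by fastforce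
  have lev: "level j Lo K M" and KE: "K \<subseteq> \<Union>E" and D\<mu>: "D ^ j \<le> \<mu>"
    and \<mu>: "\<And>q. card {v \<in> K. c v = q} \<le> \<mu>" and q0: "\<exists>q. card {v \<in> K. c v = q} = \<mu>"
    and Lo: "card {e \<in> E. e \<inter> Lo \<noteq> {}} \<le> 2 * b * \<mu>"
    using lay unfolding layer_def by simp_all
  obtain q0 where q0: "card {v \<in> K. c v = q0} = \<mu>" using q0 by (rule exE)
  have jk: "j < k" using Suc.prems by simp
  obtain N where N: "\<And>q. family Lo K q (N q)" "\<And>q e. family Lo K q (insert e (N q)) \<Longrightarrow> e \<in> N q"
    using ex_maximal_family[of Lo K] by metis
  have "{..<r} \<noteq> {}" using r_ge by (auto simp: lessThan_empty_iff)
  \<comment> \<open>Only the largest family is attached, but its size bounds the families of all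
    classes in the count.\<close>
  then obtain p where "p \<in> {..<r}" and pmax: "card (N p) = Max ((\<lambda>q. card (N q)) ` {..<r})"
    using obtains_MAX[of "{..<r}" "\<lambda>q. card (N q)"] by (metis finite_lessThan)
  have p: "card (N q) \<le> card (N p)" if "q < r" for q
    unfolding pmax using that by (intro Max_ge) auto
  define \<mu>' where "\<mu>' = card (N p)"
  note famp = familyD[OF N(1)[of p]]
  have lev': "level (Suc j) (Lo \<union> K) (\<Union>(N p) - K) (N p)"
    by (rule level_Suc[OF lev famp])
  have finK: "finite K" using lev unfolding level_def by blast
  let ?T = "{e \<in> E. e \<inter> (Lo \<union> K) \<noteq> {}}"
  have up: "card ?T \<le> 2 * b * \<mu> + b * (\<mu> + \<mu>')"
  proof -
    have tfin: "finite (touching Lo K q)" for q unfolding touching_def using finite_E by simp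
    have "?T \<subseteq> {e \<in> E. e \<inter> Lo \<noteq> {}} \<union> (\<Union>q<r. touching Lo K q)"
      unfolding touching_def using c_less by blast
    then have "card ?T \<le> card ({e \<in> E. e \<inter> Lo \<noteq> {}} \<union> (\<Union>q<r. touching Lo K q))"
      using finite_E tfin by (intro card_mono) auto
    also have "\<dots> \<le> 2 * b * \<mu> + card (\<Union>q<r. touching Lo K q)"
      using Lo card_Un_le le_trans by (meson add_le_mono1)
    also have "card (\<Union>q<r. touching Lo K q) \<le> (\<Sum>q<r. card (touching Lo K q))"
      by (intro card_UN_le) simp
    also have "\<dots> \<le> (\<Sum>q<r. (1 + r * (r + 1) * (2 * k + 1) * (r + 1)) * (\<mu> + \<mu>'))"
      using p unfolding \<mu>'_def by (intro sum_mono card_touching_le[OF lev jk nocyc N \<mu>]) auto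
    also have "\<dots> = b * (\<mu> + \<mu>')"
      by (simp only: b_def sum_constant card_lessThan mult.assoc of_nat_id)
    finally show ?thesis by simp
  qed
  have low: "\<mu> * (b * (D + 3)) \<le> card ?T"
  proof -
    let ?Q = "{v \<in> K. c v = q0}"
    have "\<mu> * (b * (D + 3)) = (\<Sum>v\<in>?Q. b * (D + 3))" using q0 by simp
    also have "\<dots> \<le> (\<Sum>v\<in>?Q. card {e \<in> E. v \<in> e})"
      using KE deg by (intro sum_mono) blast
    \<comment> \<open>An edge has one vertex per class, so the edge sets at different vertices of
      \<open>?Q\<close> are disjoint.\<close>
    also have "\<dots> = card (\<Union>v\<in>?Q. {e \<in> E. v \<in> e})"
      using finK finite_E same_class_eqI by (intro card_UN_disjoint[symmetric]) auto
    also have "\<dots> \<le> card ?T"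
      using finite_E by (intro card_mono) auto
    finally show ?thesis .
  qed
  have b0: "0 < b" unfolding b_def using r_ge by simp
  have eqs: "b * (D * \<mu> + 3 * \<mu>) = \<mu> * (b * (D + 3))"
    "b * (3 * \<mu> + \<mu>') = 2 * b * \<mu> + b * (\<mu> + \<mu>')" by (simp_all add: algebra_simps)
  have "b * (D * \<mu> + 3 * \<mu>) \<le> b * (3 * \<mu> + \<mu>')"
    using up low eqs by linarith
  then have D\<mu>': "D * \<mu> \<le> \<mu>'" using b0 by simp
  \<comment> \<open>With \<open>3 \<le> D\<close> the total \<open>b * (3 * \<mu> + \<mu>')\<close>
    is at most \<open>2 * b * \<mu>'\<close>, which restores the last clause of
    \<open>layer\<close>.\<close>
  then have "3 * \<mu> \<le> \<mu>'" using D by (meson le_trans mult_le_mono1)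
  then have "b * (3 * \<mu> + \<mu>') \<le> b * (2 * \<mu>')" by (intro mult_le_mono2) simp
  also have "\<dots> = 2 * b * \<mu>'" by simp
  finally have "card ?T \<le> 2 * b * \<mu>'" using up eqs(2) by linarith
  moreover have "D ^ Suc j \<le> \<mu>'" using D\<mu>' D\<mu> by (metis le_trans mult_le_mono2 power_Suc)
  moreover have "\<Union>(N p) - K \<subseteq> \<Union>E" using famp(1) by blast
  \<comment> \<open>A class other than \<open>p\<close> attains the size \<open>\<mu>'\<close> in
    the new layer.\<close>
  moreover have "\<exists>q. q \<noteq> p \<and> q < r"
    using r_ge by (intro exI[of _ "if p = 0 then 1 else 0"]) auto
  ultimately have "layer b D (Suc j) (Lo \<union> K) (\<Union>(N p) - K) (N p) \<mu>'"
    using lev' card_new_class[OF N(1), where p = p] unfolding \<mu>'_def layer_def by metis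
  then show ?case by blast
qed

text \<open>Without the cycle the tree reaches height \<open>k\<close>, where one class would have
  at least \<open>D ^ k\<close> vertices, more than \<open>V\<close> has.\<close>

lemma has_lcycle_of_min_degree:
  fixes k :: nat
  defines "b \<equiv> r * (1 + r * (r + 1) * (2 * k + 1) * (r + 1))"
  assumes "finite V" "\<Union>E \<subseteq> V" "card V < D ^ k" "E \<noteq> {}" "3 \<le> D"
    and "\<And>v. v \<in> \<Union>E \<Longrightarrow> b * (D + 3) \<le> card {e \<in> E. v \<in> e}"
  shows "has_lcycle E (2 * k)"
proof (rule ccontr)
  assume "\<not> ?thesis"
  then obtain Lo K M \<mu> where "layer b D k Lo K M \<mu>"
    using ex_layer[of k D k] assms unfolding b_def by blast
  then obtain q where lev: "K \<subseteq> \<Union>E" "D ^ k \<le> \<mu>" "card {v \<in> K. c v = q} = \<mu>"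
    unfolding layer_def by blast
  then have "card {v \<in> K. c v = q} \<le> card V" using assms by (intro card_mono) auto
  then show False using lev assms(4) by linarith
qed

end

section \<open>The bound\<close>

theorem corollary1p4:
  fixes r k n :: nat and C :: "'a hypergraph"
  assumes "r \<ge> 3" and "k \<ge> 2" and "n \<ge> 1"
    and "is_linear_cycle r (2 * k) C"
  shows "real (exL r n C)
    \<le> 64 * real k ^ 2 * real r ^ (2 * r + 3) * real n powr (1 + 1 / real k)"
proof (rule ccontr)
  assume neg: "\<not> ?thesis"
  let ?S = "{card (edges G) | G :: nat hypergraph.
     linear_rgraph r G \<and> card (verts G) = n \<and> \<not> contains_copy G C}"
  have "card (edges C) = 2 * k"
    using assms(4) unfolding is_linear_cycle_def by (metis bij_betw_same_card card_lessThan)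
  \<comment> \<open>As \<open>C\<close> has an edge, the edgeless hypergraph is admissible and the
    maximum is attained.\<close>
  then have "edges C \<noteq> {}" using assms(2) by auto
  then have "exL r n C \<in> ?S"
    unfolding exL_def by (intro Max_in finite_exL_set exL_set_nonempty)
  then obtain G :: "nat hypergraph" where G: "exL r n C = card (edges G)" "linear_rgraph r G"
    "card (verts G) = n" "\<not> contains_copy G C" by blast
  let ?E = "edges G" and ?V = "verts G"
  have rG: "rgraph r G" and V: "finite ?V" and E: "\<And>e. e \<in> ?E \<Longrightarrow> e \<subseteq> ?V \<and> card e = r"
    and lin: "\<And>e f. e \<in> ?E \<Longrightarrow> f \<in> ?E \<Longrightarrow> e \<noteq> f \<Longrightarrow> card (e \<inter> f) \<le> 1"
    using G(2) unfolding linear_rgraph_def rgraph_def by blast+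
  have finE: "finite ?E" using V E by (meson PowI finite_Pow_iff finite_subset subsetI)
  obtain c where c: "\<And>v. c v < r" "card ?E \<le> r ^ r * card {e \<in> ?E. inj_on c e}"
    using ex_partite_subgraph[OF V E] assms(1) by auto
  define E1 where "E1 = {e \<in> ?E. inj_on c e}"
  define N where "N = real n powr (1 / real k)"
  \<comment> \<open>Adding \<open>3\<close> ensures \<open>N < D\<close> and
    \<open>3 \<le> D\<close>, while \<open>D + 3 \<le> N + 6 \<le> 7 * N\<close> because
    \<open>1 \<le> N\<close>.\<close>
  define D where "D = nat \<lfloor>N\<rfloor> + 3"
  define b where "b = r * (1 + r * (r + 1) * (2 * k + 1) * (r + 1))"
  have N1: "1 \<le> N" unfolding N_def using assms(3) by (simp add: ge_one_powr_ge_zero)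
  have Nk: "N ^ k = real n"
    unfolding N_def using assms(2,3) by (simp add: powr_realpow[symmetric] powr_powr)
  have D: "N < real D" "real D + 3 \<le> 7 * N" "3 \<le> D"
    unfolding D_def using N1 by (simp_all, linarith+)
  have nD: "n < D ^ k"
  proof -
    have "real n < real D ^ k"
      unfolding Nk[symmetric] using D(1) N1 assms(2) by (intro power_strict_mono) auto
    then show ?thesis by (metis of_nat_less_iff of_nat_power)
  qed
  \<comment> \<open>From \<open>r \<ge> 3\<close> and \<open>k \<ge> 2\<close>:
    \<open>(r + 1)^2 \<le> 16/9 * r^2\<close> and \<open>2 * k + 1 \<le> 5/2 * k\<close> give
    \<open>40/9\<close>, and the lone \<open>r\<close> costs at most \<open>1/2\<close>.\<close>
  have b: "real b \<le> 5 * real k * real r ^ 4"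
  proof -
    have r: "real r \<ge> 3" and k: "real k \<ge> 2" using assms by auto
    have rr: "(real r + 1) ^ 2 \<le> 16 / 9 * real r ^ 2"
    proof -
      have "real r + 1 \<le> 4 / 3 * real r" using r by simp
      then have "(real r + 1) ^ 2 \<le> (4 / 3 * real r) ^ 2" using r by (intro power_mono) auto
      then show ?thesis by (simp add: power2_eq_square)
    qed
    have "real b = real r + real r ^ 2 * ((real r + 1) ^ 2 * (2 * real k + 1))"
      unfolding b_def by (simp add: algebra_simps power2_eq_square)
    also have "\<dots> \<le> real r + real r ^ 2 * ((16 / 9 * real r ^ 2) * (5 / 2 * real k))"
      using rr r k by (intro add_left_mono mult_left_mono mult_mono) auto
    also have "\<dots> = real r + 40 / 9 * (real k * real r ^ 4)"
      by (simp add: power2_eq_square power4_eq_xxxx)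
    finally have "real b \<le> real r + 40 / 9 * (real k * real r ^ 4)" .
    moreover have "real r \<le> 1 / 2 * (real k * real r ^ 4)"
    proof -
      have "real r ^ 1 \<le> real r ^ 4" using r by (intro power_increasing) auto
      also have "\<dots> \<le> 1 / 2 * (real k * real r ^ 4)" using k r by simp
      finally show ?thesis by simp
    qed
    moreover have "0 \<le> real k * real r ^ 4" by simp
    ultimately show ?thesis by linarith
  qed
  \<comment> \<open>Of \<open>r ^ (2 * r + 3)\<close> a factor \<open>r ^ r\<close> pays for the
    colouring, and \<open>r ^ (r + 3)\<close> covers the \<open>r ^ 4\<close> in \<open>b\<close>.
    The factors \<open>5\<close> and \<open>7\<close> give
    \<open>35 * k \<le> 64 * k^2\<close>.\<close>
  have big: "b * (D + 3) * card ?V < card E1"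
  proof -
    have r: "real r \<ge> 3" and k: "real k \<ge> 2" using assms by auto
    have pw: "real r ^ (2 * r + 3) = real r ^ r * real r ^ (r + 3)"
      unfolding power_add[symmetric] by (rule arg_cong[of _ _ "(^) (real r)"]) simp
    have "64 * real k ^ 2 * real r ^ (2 * r + 3) * (real n * N) < real (card ?E)"
      using neg G(1) assms(3) unfolding N_def by (simp add: powr_add)
    also have "\<dots> \<le> real r ^ r * real (card E1)"
      using c(2) unfolding E1_def[symmetric] by (metis of_nat_le_iff of_nat_mult of_nat_power)
    finally have "real r ^ r * (64 * real k ^ 2 * real r ^ (r + 3) * (real n * N)) < real r ^ r * real (card E1)"
      unfolding pw by (simp only: ac_simps)
    then have E1: "64 * real k ^ 2 * real r ^ (r + 3) * (real n * N) < real (card E1)"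
      using r by (simp add: mult_less_cancel_left)
    have "real (b * (D + 3) * card ?V) = real b * (real D + 3) * real n" by (simp add: G(3))
    also have "\<dots> \<le> (5 * real k * real r ^ 4) * (7 * N) * real n"
      using b D(2) by (intro mult_right_mono mult_mono) auto
    also have "\<dots> = (35 * real k * real r ^ 4) * (real n * N)" by (simp add: mult_ac)
    also have "\<dots> \<le> (64 * real k ^ 2 * real r ^ (r + 3)) * (real n * N)"
    proof (rule mult_right_mono, rule mult_mono)
      show "35 * real k \<le> 64 * real k ^ 2" using k by (simp add: power2_eq_square)
      show "real r ^ 4 \<le> real r ^ (r + 3)" using assms(1) by (intro power_increasing) auto
    qed (use N1 in auto)
    finally show ?thesis using E1 by (metis le_less_trans of_nat_less_iff)
  qed
  have "\<exists>E2. E2 \<subseteq> E1 \<and> E2 \<noteq> {} \<and> (\<forall>e\<in>E2. \<forall>v\<in>e. b * (D + 3) < card {g \<in> E2. v \<in> g})"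
    using V finE E by (intro ex_large_min_degree[OF _ _ _ big]) (auto simp: E1_def)
  then obtain E2 where E2: "E2 \<subseteq> E1" "E2 \<noteq> {}"
    "\<And>e v. e \<in> E2 \<Longrightarrow> v \<in> e \<Longrightarrow> b * (D + 3) < card {g \<in> E2. v \<in> g}" by blast
  have E2G: "E2 \<subseteq> ?E" "\<And>e. e \<in> E2 \<Longrightarrow> inj_on c e" using E2(1) unfolding E1_def by blast+
  interpret partite_linear E2 r c
  proof
    show "finite E2" using E2G(1) finE finite_subset by blast
  qed (use E2G E lin c assms(1) in \<open>auto simp: subset_iff\<close>)
  have "has_lcycle E2 (2 * k)"
  proof (rule has_lcycle_of_min_degree[OF V _ _ E2(2) D(3)])
    show "\<Union>E2 \<subseteq> ?V" using E2G(1) E by blast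
    show "card ?V < D ^ k" using nD G(3) by simp
  qed (use E2(3) in \<open>fastforce simp: b_def\<close>)
  then obtain e where "cyc_seq r (2 * k) e" "\<forall>i<2 * k. e i \<in> E2"
    using has_lcycle_cyc_seq[of E2 "2 * k" r] card_edge by blast
  then have "contains_copy G C"
    using E2G(1) assms rG by (intro contains_copy_of_cyc_seq[of "2 * k" r C e]) auto
  then show False using G(4) by simp
qed

end
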